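(* Let $G$ be a finite simple graph on $n$ vertices with independence number $\alpha=\alpha(G)$, independence polynomial $P_G(x)$, and let $M(G)$ be the multiplicity of $x=-1$ as a root of $P_G(x)$. Then $$\deg h_{R/I(G)}(t)=\alpha-M(G),$$ and, if $G$ has at least one edge, $$\deg h_{R/J(G)}(t)=n-2-M(G).$$ In particular, $\deg h_{R/I(G)}(t)=\alpha$ if and only if $P_G(-1)\neq 0$.
   Context: $\Bbbk$ is a field and $R=\Bbbk[x_1,\dots,x_n]$ with the standard grading, the variables being indexed by the vertices $1,\dots,n$ of $G$. The edge ideal is $I(G)=(x_ix_j:\{i,j\}\in E(G))$ and the cover ideal is $J(G)=\bigl(\prod_{i\in C}x_i : C \text{ a minimal vertex cover of } G\bigr)=\bigcap_{\{i,j\}\in E(G)}(x_i,x_j)$. For a standard graded $\Bbbk$-algebra $A$ with Hilbert series $H_A(t)$, the $h$-polynomial $h_A(t)\in\mathbb{Z}[t]$ is the unique polynomial with $H_A(t)=h_A(t)/(1-t)^{\dim A}$. The independence polynomial is $P_G(x)=\sum_{i=0}^{\alpha}g_ix^i\in\mathbb{Z}[x]$, where $g_i$ is the number of independent sets of $G$ of size $i$ (so $g_0=1$). $M(G)$ is the multiplicity of $-1$ as a root of $P_G(x)$, viewed as a polynomial over $\mathbb{Q}$; it is $0$ if $P_G(-1)\ne0$. *)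

theory Defs
  imports
    "HOL-Algebra.Embedded_Algebras"
    "HOL-Algebra.QuotRing"
    "HOL-Library.Poly_Mapping"
    "HOL-Library.Extended_Nat"
    "HOL-Computational_Algebra.Polynomial_FPS"
    "Graph_Theory.Pair_Digraph"
begin

section \<open>Independent sets and vertex covers\<close>

text \<open>
  A finite simple graph is a \<^locale>\<open>pair_graph\<close>: a finite, loop-free, symmetric digraph without
  parallel arcs. An undirected edge \<open>{u, v}\<close> is the pair of arcs \<open>(u, v)\<close>, \<open>(v, u)\<close>.
\<close>

definition independent_set :: "'v pair_pre_digraph \<Rightarrow> 'v set \<Rightarrow> bool" where
  "independent_set G S \<longleftrightarrow> S \<subseteq> pverts G \<and> (\<forall>u\<in>S. \<forall>v\<in>S. (u, v) \<notin> parcs G)"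

definition independence_number :: "'v pair_pre_digraph \<Rightarrow> nat" where
  "independence_number G = Max (card ` {S. independent_set G S})"

definition independence_poly :: "'v pair_pre_digraph \<Rightarrow> int poly" where
  "independence_poly G =
     (\<Sum>i\<le>independence_number G. monom (int (card {S. independent_set G S \<and> card S = i})) i)"

text \<open>\<^const>\<open>Polynomial.order\<close> is 0 at a point that is not a root.\<close>

definition mult_minus_one :: "'v pair_pre_digraph \<Rightarrow> nat" where
  "mult_minus_one G = Polynomial.order (-1) (map_poly rat_of_int (independence_poly G))"

definition vertex_cover :: "'v pair_pre_digraph \<Rightarrow> 'v set \<Rightarrow> bool" where
  "vertex_cover G C \<longleftrightarrow> C \<subseteq> pverts G \<and> (\<forall>(u, v)\<in>parcs G. u \<in> C \<or> v \<in> C)"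

definition minimal_vertex_cover :: "'v pair_pre_digraph \<Rightarrow> 'v set \<Rightarrow> bool" where
  "minimal_vertex_cover G C \<longleftrightarrow> vertex_cover G C \<and> (\<forall>D. D \<subset> C \<longrightarrow> \<not> vertex_cover G D)"


section \<open>The polynomial ring over a field, with variables indexed by a set\<close>

text \<open>
  A monomial is its exponent function \<open>'v \<Rightarrow>\<^sub>0 nat\<close>; a polynomial maps monomials to coefficients.
  The variables of \<open>mpoly_ring V\<close> are the \<open>mvar v\<close> with \<open>v \<in> V\<close>.
\<close>

type_synonym ('v, 'k) mpoly = "('v \<Rightarrow>\<^sub>0 nat) \<Rightarrow>\<^sub>0 'k"

definition mvar :: "'v \<Rightarrow> ('v, 'k::field) mpoly" where
  "mvar v = Poly_Mapping.single (Poly_Mapping.single v 1) 1"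

definition mconst :: "'k::field \<Rightarrow> ('v, 'k) mpoly" where
  "mconst c = Poly_Mapping.single 0 c"

definition mpoly_ring :: "'v set \<Rightarrow> ('v, 'k::field) mpoly ring" where
  "mpoly_ring V = \<lparr>carrier = {f. \<forall>m\<in>Poly_Mapping.keys f. Poly_Mapping.keys m \<subseteq> V},
     monoid.mult = (*), one = 1, zero = 0, add = (+)\<rparr>"

definition monomial_degree :: "('v \<Rightarrow>\<^sub>0 nat) \<Rightarrow> nat" where
  "monomial_degree m = (\<Sum>v\<in>Poly_Mapping.keys m. Poly_Mapping.lookup m v)"

definition homogeneous_part :: "'v set \<Rightarrow> nat \<Rightarrow> ('v, 'k::field) mpoly set" where
  "homogeneous_part V d =
     {f \<in> carrier (mpoly_ring V). \<forall>m\<in>Poly_Mapping.keys f. monomial_degree m = d}"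

lemma cring_mpoly_ring: "cring (mpoly_ring V :: ('v, 'k::field) mpoly ring)"
proof (intro cringI abelian_groupI comm_monoidI)
  fix f assume "f \<in> carrier (mpoly_ring V :: ('v, 'k) mpoly ring)"
  then show "\<exists>g\<in>carrier (mpoly_ring V). g \<oplus>\<^bsub>mpoly_ring V\<^esub> f = \<zero>\<^bsub>mpoly_ring V\<^esub>"
    by (intro bexI[of _ "- f"]) (auto simp: mpoly_ring_def)
next
  fix f g :: "('v, 'k) mpoly" assume fg: "f \<in> carrier (mpoly_ring V :: ('v, 'k) mpoly ring)" "g \<in> carrier (mpoly_ring V)"
  show "f \<oplus>\<^bsub>mpoly_ring V\<^esub> g \<in> carrier (mpoly_ring V)"
    using fg Poly_Mapping.keys_add[of f g] by (auto simp: mpoly_ring_def)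
  show "f \<otimes>\<^bsub>mpoly_ring V\<^esub> g \<in> carrier (mpoly_ring V)"
  proof -
    have "Poly_Mapping.keys m \<subseteq> V" if m: "m \<in> Poly_Mapping.keys (f * g)" for m
    proof -
      obtain a b where ab: "a \<in> Poly_Mapping.keys f" "b \<in> Poly_Mapping.keys g" "m = a + b"
        using m keys_mult[of f g] by blast
      then show ?thesis
        using fg Poly_Mapping.keys_add[of a b] by (fastforce simp: mpoly_ring_def)
    qed
    then show ?thesis by (simp add: mpoly_ring_def)
  qed
qed (auto simp: mpoly_ring_def algebra_simps)


section \<open>Krull dimension, Hilbert series and \<open>h\<close>-polynomial\<close>

text \<open>The supremum of the lengths of chains of prime ideals (0 for the zero ring).\<close>

definition krull_dim :: "('a, 'b) ring_scheme \<Rightarrow> enat" where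
  "krull_dim A = Sup {enat n | n. \<exists>P. (\<forall>i\<le>n. primeideal (P i) A) \<and> (\<forall>i<n. P i \<subset> P (Suc i))}"

text \<open>
  A graded algebra is given by a ring \<open>A\<close>, the field of scalars \<open>K\<close> as a subset of \<open>A\<close>, and the
  homogeneous components \<open>gr d\<close>. The function \<^const>\<open>ring.dim\<close> is the vector space dimension.
\<close>

definition hilbert_series :: "('a, 'b) ring_scheme \<Rightarrow> 'a set \<Rightarrow> (nat \<Rightarrow> 'a set) \<Rightarrow> int fps" where
  "hilbert_series A K gr = Abs_fps (\<lambda>d. int (ring.dim A K (gr d)))"

definition h_poly :: "('a, 'b) ring_scheme \<Rightarrow> 'a set \<Rightarrow> (nat \<Rightarrow> 'a set) \<Rightarrow> int poly" where
  "h_poly A K gr =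
     (THE h. fps_of_poly h = hilbert_series A K gr * (1 - fps_X) ^ the_enat (krull_dim A))"

text \<open>
  The \<open>h\<close>-polynomial of \<open>R/I\<close> for a homogeneous ideal \<open>I\<close> of \<open>R = mpoly_ring V\<close>, graded by the
  images of the homogeneous parts of \<open>R\<close>.
\<close>

definition h_poly_quot :: "'v set \<Rightarrow> ('v, 'k::field) mpoly set \<Rightarrow> int poly" where
  "h_poly_quot V I = h_poly (mpoly_ring V Quot I)
     ((\<lambda>c. I +>\<^bsub>mpoly_ring V\<^esub> mconst c) ` UNIV)
     (\<lambda>d. (\<lambda>f. I +>\<^bsub>mpoly_ring V\<^esub> f) ` homogeneous_part V d)"


section \<open>Edge ideal and cover ideal\<close>

definition edge_ideal :: "'v pair_pre_digraph \<Rightarrow> ('v, 'k::field) mpoly set" where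
  "edge_ideal G = Idl\<^bsub>mpoly_ring (pverts G)\<^esub> {mvar u * mvar v | u v. (u, v) \<in> parcs G}"

definition cover_ideal :: "'v pair_pre_digraph \<Rightarrow> ('v, 'k::field) mpoly set" where
  "cover_ideal G =
     Idl\<^bsub>mpoly_ring (pverts G)\<^esub> {(\<Prod>v\<in>C. mvar v) | C. minimal_vertex_cover G C}"

end

theory Submission
  imports Defs
begin

text \<open>
  Both ideals are generated by squarefree monomials, so each is the Stanley--Reisner ideal of a
  simplicial complex \<open>\<Delta>\<close> on the vertices: a polynomial lies in the ideal iff no monomial in it has
  its support in \<open>\<Delta>\<close>. For the edge ideal \<open>\<Delta>\<close> consists of the independent sets, for the cover ideal
  of the sets that are not vertex covers, that is, of the complements of the dependent sets.

  Let \<open>D\<close> be the largest size of a face. The monomials with support in \<open>\<Delta>\<close> are a basis of the quotient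
  (\<open>dim_homogeneous_part\<close>); those with support exactly \<open>S\<close> contribute \<open>(t / (1 - t)) ^ card S\<close> to the
  Hilbert series. The Krull dimension of the quotient is \<open>D\<close> (\<open>krull_dim_quotient\<close>). Hence the
  \<open>h\<close>-polynomial is the sum of \<open>t ^ card S * (1 - t) ^ (D - card S)\<close> over the faces \<open>S\<close>, which is the
  face polynomial \<open>f(x)\<close>, the sum of the \<open>x ^ card S\<close>, homogenized to degree \<open>D\<close> and evaluated at
  \<open>(t, 1 - t)\<close>.

  On the line \<open>a + b = 1\<close> the homogenization of \<open>x + 1\<close> is \<open>1\<close>. So every factor \<open>x + 1\<close> of \<open>f\<close>
  disappears and lowers the degree in \<open>t\<close> by one, and what remains has as its leading coefficient the
  value at \<open>-1\<close> of the cofactor, up to sign, which is not zero. The degree is therefore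
  \<open>D - order (-1) f\<close> (\<open>degree_homogenization\<close>). For the independence complex \<open>f\<close> is the independence
  polynomial and \<open>D\<close> the independence number, and this is the first claim and the equivalence.

  For the cover ideal \<open>D = n - 2\<close>, since a largest set that is not a cover omits exactly the two ends
  of an edge. The sum of \<open>t ^ card S * (1 - t) ^ (n - card S)\<close> over all sets \<open>S\<close> of vertices is
  \<open>(t + (1 - t)) ^ n = 1\<close>, so passing to complements gives
  \<open>(1 - t)\<^sup>2 * h = 1 - H\<close>, where \<open>H\<close> is the independence polynomial homogenized to degree \<open>n\<close> and
  evaluated at \<open>(1 - t, t)\<close>. By the same degree formula \<open>H\<close> has degree \<open>n - M\<close>, where \<open>M\<close> is the
  multiplicity of the root \<open>-1\<close> of the independence polynomial. This degree is positive, because \<open>M\<close> is at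
  most the independence number, and that is below \<open>n\<close> once there is an edge; so \<open>h\<close> has degree
  \<open>n - M - 2\<close>.
\<close>

section \<open>Homogenized polynomials on the line \<open>a + b = 1\<close>\<close>

definition homogenization :: "nat \<Rightarrow> 'a::comm_ring_1 poly \<Rightarrow> 'a poly \<Rightarrow> 'a poly \<Rightarrow> 'a poly" where
  "homogenization n f a b = (\<Sum>i\<le>n. smult (coeff f i) (a ^ i * b ^ (n - i)))"

text \<open>
  Homogenization is multiplicative, and \<open>x + 1\<close> homogenizes to \<open>a + b\<close>.
\<close>

lemma homogenization_linear_factor:
  assumes "degree g \<le> n"
  shows "homogenization (Suc n) ([:1, 1:] * g) a b = (a + b) * homogenization n g a b"
proof -
  have c: "coeff ([:1, 1:] * g) (Suc i) = coeff g (Suc i) + coeff g i" for i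
    by simp
  have "b * homogenization n g a b = (\<Sum>i\<le>n. smult (coeff g i) (a ^ i * b ^ (Suc n - i)))"
    by (simp add: homogenization_def sum_distrib_left Suc_diff_le algebra_simps)
  also have "\<dots> = (\<Sum>i\<le>Suc n. smult (coeff g i) (a ^ i * b ^ (Suc n - i)))"
    using assms by (simp add: coeff_eq_0)
  finally have b: "b * homogenization n g a b =
      smult (coeff g 0) (b ^ Suc n) + (\<Sum>i\<le>n. smult (coeff g (Suc i)) (a ^ Suc i * b ^ (n - i)))"
    by (simp add: sum.atMost_Suc_shift del: sum.atMost_Suc)
  have a: "a * homogenization n g a b = (\<Sum>i\<le>n. smult (coeff g i) (a ^ Suc i * b ^ (n - i)))"
    by (simp add: homogenization_def sum_distrib_left algebra_simps)
  have "homogenization (Suc n) ([:1, 1:] * g) a b =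
      smult (coeff g 0) (b ^ Suc n)
      + (\<Sum>i\<le>n. smult (coeff g (Suc i) + coeff g i) (a ^ Suc i * b ^ (n - i)))"
    unfolding homogenization_def by (subst sum.atMost_Suc_shift) (simp only: c, simp)
  also have "\<dots> = b * homogenization n g a b + a * homogenization n g a b"
    unfolding a b by (simp add: smult_add_left sum.distrib del: power_Suc)
  finally show ?thesis by (simp add: algebra_simps)
qed

lemma homogenization_linear_power:
  assumes "a + b = 1" "k + degree g \<le> n"
  shows "homogenization n ([:1, 1:] ^ k * g) a b = homogenization (n - k) g a b"
  using assms(2)
proof (induction k arbitrary: n)
  case (Suc k)
  then obtain n' where n: "n = Suc n'" by (cases n) auto
  have "degree ([:1, 1:] ^ k * g) \<le> degree ([:1, 1:] ^ k :: 'a poly) + degree g"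
    by (rule degree_mult_le)
  also have "degree ([:1, 1:] ^ k :: 'a poly) \<le> k"
    using degree_power_le[of "[:1, 1:] :: 'a poly" k] by simp
  finally have "degree ([:1, 1:] ^ k * g) \<le> n'" using Suc.prems n by simp
  from homogenization_linear_factor[OF this, of a b] show ?case
    using Suc assms(1) n by (simp add: mult.assoc del: mult_pCons_left)
qed simp

lemma coeff_mult_at_degree_bounds:
  fixes p q :: "'a::comm_ring_1 poly"
  assumes "degree p \<le> m" "degree q \<le> n"
  shows "coeff (p * q) (m + n) = coeff p m * coeff q n"
proof -
  have "coeff (p * q) (m + n) = (\<Sum>i\<le>m + n. coeff p i * coeff q (m + n - i))"
    by (rule coeff_mult)
  also have "\<dots> = (\<Sum>i\<in>{m}. coeff p i * coeff q (m + n - i))"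
  proof (rule sum.mono_neutral_right)
    show "\<forall>i\<in>{..m + n} - {m}. coeff p i * coeff q (m + n - i) = 0"
    proof
      fix i assume "i \<in> {..m + n} - {m}"
      then have "i > m \<or> m + n - i > n" by auto
      then show "coeff p i * coeff q (m + n - i) = 0"
        using assms by (auto simp: coeff_eq_0)
    qed
  qed auto
  finally show ?thesis by simp
qed

lemma degree_linear_power_le: "degree ([:c, e:] ^ n) \<le> n"
  using degree_power_le[of "[:c, e:]" n] by (simp split: if_splits)

lemma coeff_linear_power_top: "coeff ([:c, e:] ^ n) n = (e::'a::comm_ring_1) ^ n"
proof (induction n)
  case (Suc n)
  then show ?case
    using coeff_mult_at_degree_bounds[of "[:c, e:]" 1 "[:c, e:] ^ n" n]
    by (simp add: degree_linear_power_le)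
qed simp

text \<open>
  The linear polynomials \<open>a\<close> and \<open>b\<close> with \<open>a + b = 1\<close> have opposite leading coefficients \<open>e\<close> and \<open>-e\<close>.
  After the factors \<open>x + 1\<close> of \<open>f\<close> are removed, the coefficient of \<open>t ^ m\<close> in the homogenized cofactor
  \<open>q\<close> is thus \<open>(-e) ^ m * q(-1)\<close>. Both \<open>(a, b) = (t, 1 - t)\<close> and \<open>(a, b) = (1 - t, t)\<close> will occur.
\<close>

lemma degree_homogenization:
  fixes f :: "'a::idom poly"
  assumes f: "f \<noteq> 0" "degree f \<le> n" and e: "e \<noteq> 0"
  shows "degree (homogenization n f [:c, e:] [:1 - c, - e:]) = n - order (-1) f"
proof -
  define k where "k = order (-1) f"
  obtain q where q: "f = [:1, 1:] ^ k * q" "\<not> [:1, 1:] dvd q"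
    using order_decomp[OF f(1), of "-1"] by (auto simp: k_def)
  have q1: "poly q (-1) \<noteq> 0" and q0: "q \<noteq> 0"
    using q(2) by (auto simp: poly_eq_0_iff_dvd)
  have "degree f = k + degree q"
    using q0 unfolding q(1) by (subst degree_mult_eq) (auto simp: degree_power_eq)
  then have kn: "k + degree q \<le> n" using f(2) by simp
  define m where "m = n - k"
  have dq: "degree q \<le> m" using kn by (simp add: m_def)
  let ?h = "homogenization m q [:c, e:] [:1 - c, - e:]"
  have eq: "homogenization n f [:c, e:] [:1 - c, - e:] = ?h"
    unfolding q(1) m_def by (rule homogenization_linear_power) (use kn in auto)
  have le: "degree ([:c, e:] ^ i * [:1 - c, - e:] ^ (m - i)) \<le> m" if "i \<le> m" for i
    using degree_mult_le[of "[:c, e:] ^ i" "[:1 - c, - e:] ^ (m - i)"]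
      degree_linear_power_le[of c e i] degree_linear_power_le[of "1 - c" "- e" "m - i"] that
    by simp
  have "degree ?h \<le> m"
    unfolding homogenization_def
    by (intro degree_sum_le) (use le in \<open>auto intro: order.trans[OF degree_smult_le]\<close>)
  have "coeff ?h m = (\<Sum>i\<le>m. coeff q i * ((-1) ^ i * (- e) ^ m))"
    unfolding homogenization_def coeff_sum
  proof (rule sum.cong)
    fix i assume i: "i \<in> {..m}"
    have "coeff ([:c, e:] ^ i * [:1 - c, - e:] ^ (m - i)) m = e ^ i * (- e) ^ (m - i)"
      using coeff_mult_at_degree_bounds[of "[:c, e:] ^ i" i "[:1 - c, - e:] ^ (m - i)" "m - i"] i
      by (simp add: degree_linear_power_le coeff_linear_power_top)
    also have "e ^ i = (-1) ^ i * (- e) ^ i"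
      by (simp flip: power_mult_distrib)
    also have "(-1) ^ i * (- e) ^ i * (- e) ^ (m - i) = (-1) ^ i * (- e) ^ m"
      using i by (simp add: mult.assoc flip: power_add)
    finally show "coeff (smult (coeff q i) ([:c, e:] ^ i * [:1 - c, - e:] ^ (m - i))) m
        = coeff q i * ((-1) ^ i * (- e) ^ m)" by simp
  qed simp
  also have "\<dots> = (\<Sum>i\<le>m. coeff q i * (-1) ^ i) * (- e) ^ m"
    by (simp add: sum_distrib_right mult.assoc)
  also have "(\<Sum>i\<le>m. coeff q i * (-1) ^ i) = poly q (-1)"
    unfolding poly_altdef
    by (rule sum.mono_neutral_right) (use dq in \<open>auto simp: coeff_eq_0\<close>)
  finally have "coeff ?h m \<noteq> 0" using q1 e by simp
  then have "degree ?h = m" using \<open>degree ?h \<le> m\<close> le_degree by (metis le_antisym)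
  then show ?thesis by (simp add: eq m_def k_def)
qed

lemma order_map_poly_of_int:
  fixes p :: "int poly"
  assumes "p \<noteq> 0"
  shows "order (of_int a) (map_poly of_int p :: 'a::{idom, ring_char_0} poly) = order a p"
proof -
  let ?M = "map_poly of_int :: int poly \<Rightarrow> 'a poly"
  have mult: "?M (f * g) = ?M f * ?M g" for f g
    by (rule poly_eqI) (simp add: coeff_map_poly coeff_mult)
  have pow: "?M (f ^ n) = ?M f ^ n" for f n
    by (induction n) (simp_all add: mult map_poly_1)
  obtain q where q: "p = [:- a, 1:] ^ order a p * q" "\<not> [:- a, 1:] dvd q"
    using order_decomp[OF assms, of a] by auto
  have "poly (?M q) (of_int a) = of_int (poly q a)"
    by (induction q) (auto simp: map_poly_pCons)
  then have q1: "poly (?M q) (of_int a) \<noteq> 0" using q(2) by (simp add: poly_eq_0_iff_dvd)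
  have l: "?M [:- a, 1:] = [:- of_int a, 1:]" by (simp add: map_poly_pCons)
  have "?M p = [:- of_int a, 1:] ^ order a p * ?M q"
    by (subst q(1)) (simp only: mult pow l)
  also have "order (of_int a) \<dots> = order a p + order (of_int a) (?M q)"
    using q1 by (subst order_mult) (auto simp: order_power_n_n)
  also have "order (of_int a) (?M q) = 0" using q1 by (rule order_0I)
  finally show ?thesis by simp
qed

section \<open>Counting monomials\<close>

lemma keys_add_monomial: "Poly_Mapping.keys (a + b) = Poly_Mapping.keys a \<union> Poly_Mapping.keys (b :: 'v \<Rightarrow>\<^sub>0 nat)"
  by (auto simp: in_keys_iff lookup_add)

lemma monomial_degree_superset:
  assumes "finite V" "Poly_Mapping.keys m \<subseteq> V"
  shows "monomial_degree m = (\<Sum>v\<in>V. Poly_Mapping.lookup m v)"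
  unfolding monomial_degree_def
  by (rule sum.mono_neutral_left) (use assms in \<open>auto simp: in_keys_iff\<close>)

lemma monomial_degree_add: "monomial_degree (a + b) = monomial_degree a + monomial_degree b"
  by (simp add: monomial_degree_superset[of "Poly_Mapping.keys a \<union> Poly_Mapping.keys b"]
      keys_add_monomial lookup_add sum.distrib)

lemma monomial_degree_single [simp]: "monomial_degree (Poly_Mapping.single v n) = n"
  by (simp add: monomial_degree_def)

lemma lookup_le_monomial_degree: "Poly_Mapping.lookup m v \<le> monomial_degree m"
proof (cases "v \<in> Poly_Mapping.keys m")
  case True
  then show ?thesis unfolding monomial_degree_def by (intro member_le_sum) auto
qed (simp add: not_in_keys_iff_lookup_eq_zero)

definition monomial_box :: "'v set \<Rightarrow> nat \<Rightarrow> ('v \<Rightarrow>\<^sub>0 nat) set" where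
  "monomial_box V B = {m. Poly_Mapping.keys m \<subseteq> V \<and> (\<forall>v. Poly_Mapping.lookup m v \<le> B)}"

lemma monomial_box_bij:
  assumes "finite V"
  shows "bij_betw (\<lambda>m. restrict (Poly_Mapping.lookup m) V) (monomial_box V B) (V \<rightarrow>\<^sub>E {..B})"
proof (rule bij_betwI)
  let ?g = "\<lambda>h v. if v \<in> V then h v else (0::nat)"
  have l: "Poly_Mapping.lookup (Abs_poly_mapping (?g h)) = ?g h" for h
    by (intro lookup_Abs_poly_mapping) (rule finite_subset[OF _ assms], auto)
  show "(\<lambda>m. restrict (Poly_Mapping.lookup m) V) \<in> monomial_box V B \<rightarrow> V \<rightarrow>\<^sub>E {..B}"
    by (auto simp: monomial_box_def)
  show "(\<lambda>h. Abs_poly_mapping (?g h)) \<in> (V \<rightarrow>\<^sub>E {..B}) \<rightarrow> monomial_box V B"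
    by (auto simp: monomial_box_def in_keys_iff l split: if_splits)
  fix m :: "'a \<Rightarrow>\<^sub>0 nat"
  assume "m \<in> monomial_box V B"
  then have "?g (restrict (Poly_Mapping.lookup m) V) = Poly_Mapping.lookup m"
    by (force simp: monomial_box_def in_keys_iff fun_eq_iff)
  then show "Abs_poly_mapping (?g (restrict (Poly_Mapping.lookup m) V)) = m" by simp
next
  let ?g = "\<lambda>h v. if v \<in> V then h v else (0::nat)"
  fix h assume "h \<in> V \<rightarrow>\<^sub>E {..B}"
  moreover have l: "Poly_Mapping.lookup (Abs_poly_mapping (?g h)) = ?g h" for h
    by (intro lookup_Abs_poly_mapping) (rule finite_subset[OF _ assms], auto)
  ultimately show "restrict (Poly_Mapping.lookup (Abs_poly_mapping (?g h))) V = h"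
    by (auto simp: fun_eq_iff l PiE_def extensional_def)
qed

lemma finite_monomial_box: "finite V \<Longrightarrow> finite (monomial_box V B)"
  using bij_betw_finite[OF monomial_box_bij] by (auto intro: finite_PiE)

lemma card_monomial_box: "finite V \<Longrightarrow> card (monomial_box V B) = (B + 1) ^ card V"
  by (simp add: bij_betw_same_card[OF monomial_box_bij] card_PiE)

definition monomials_of_support :: "'v set \<Rightarrow> nat \<Rightarrow> ('v \<Rightarrow>\<^sub>0 nat) set" where
  "monomials_of_support S d = {m. Poly_Mapping.keys m = S \<and> monomial_degree m = d}"

lemma finite_monomials_of_support: "finite S \<Longrightarrow> finite (monomials_of_support S d)"
  by (rule finite_subset[OF _ finite_monomial_box[of S d]])
     (auto simp: monomials_of_support_def monomial_box_def lookup_le_monomial_degree)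

text \<open>
  Dividing by \<open>x\<close> a monomial in which \<open>x\<close> occurs either keeps its support or removes \<open>x\<close> from it.
\<close>

lemma monomials_of_support_insert_Suc:
  assumes "x \<notin> S"
  shows "monomials_of_support (insert x S) (Suc d) = (\<lambda>m. m + Poly_Mapping.single x 1) `
           (monomials_of_support S d \<union> monomials_of_support (insert x S) d)" (is "?L = ?f ` ?R")
proof (intro equalityI subsetI)
  fix m assume m: "m \<in> ?L"
  define m' where "m' = m - Poly_Mapping.single x 1"
  have "Poly_Mapping.lookup m x \<noteq> 0" using m by (auto simp: monomials_of_support_def in_keys_iff)
  then have mm: "m = ?f m'"
    by (intro poly_mapping_eqI) (auto simp: m'_def lookup_add lookup_minus lookup_single when_def)
  have k: "insert x (Poly_Mapping.keys m') = insert x S" and d: "monomial_degree m' = d"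
    using m by (simp_all add: monomials_of_support_def mm keys_add_monomial monomial_degree_add)
  have "Poly_Mapping.keys m' = S \<or> Poly_Mapping.keys m' = insert x S"
    using k assms by (metis insert_absorb insert_ident)
  then have "m' \<in> ?R"
    using d by (simp add: monomials_of_support_def disj_commute)
  then show "m \<in> ?f ` ?R" by (rule rev_image_eqI) (fact mm)
next
  fix m assume "m \<in> ?f ` ?R"
  then obtain m' where "m = ?f m'"
    "Poly_Mapping.keys m' = S \<or> Poly_Mapping.keys m' = insert x S" "monomial_degree m' = d"
    unfolding monomials_of_support_def by blast
  then show "m \<in> ?L"
    by (elim disjE) (simp_all add: monomials_of_support_def keys_add_monomial monomial_degree_add)
qed

lemma card_monomials_of_support_Suc:
  assumes "finite S" "x \<notin> S"
  shows "card (monomials_of_support (insert x S) (Suc d))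
       = card (monomials_of_support S d) + card (monomials_of_support (insert x S) d)"
proof -
  have "monomials_of_support S d \<inter> monomials_of_support (insert x S) d = {}"
    using assms by (auto simp: monomials_of_support_def)
  then show ?thesis
    unfolding monomials_of_support_insert_Suc[OF assms(2)] using assms
    by (subst card_image) (auto simp: card_Un_disjoint finite_monomials_of_support)
qed

text \<open>
  The generating function by degree of the monomials with support \<open>S\<close> is \<open>(t / (1 - t)) ^ card S\<close>:
  the recursion above says that one more variable multiplies it by \<open>t / (1 - t)\<close>.
\<close>

lemma monomials_of_support_series:
  fixes S :: "'v set"
  assumes "finite S"
  shows "Abs_fps (\<lambda>d. int (card (monomials_of_support S d))) * (1 - fps_X) ^ card S = fps_X ^ card S"
  using assms
proof (induction S)
  case empty
  have "monomials_of_support ({} :: 'v set) d = (if d = 0 then {0} else {})" for d :: nat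
    by (auto simp: monomials_of_support_def monomial_degree_def)
  then show ?case by (intro fps_ext) (simp add: fps_one_nth)
next
  case (insert x S)
  let ?F = "\<lambda>S. Abs_fps (\<lambda>d. int (card (monomials_of_support S d)))"
  have "?F (insert x S) * (1 - fps_X) = fps_X * ?F S"
  proof (rule fps_ext)
    fix d
    have "m \<notin> monomials_of_support (insert x S) 0" for m
      using lookup_le_monomial_degree[of m x] in_keys_iff[of x m]
      by (auto simp: monomials_of_support_def)
    then have "monomials_of_support (insert x S) 0 = {}" by blast
    then have "int (card (monomials_of_support (insert x S) d)) =
        (if d = 0 then 0 else int (card (monomials_of_support S (d - 1)))
          + int (card (monomials_of_support (insert x S) (d - 1))))"
      using card_monomials_of_support_Suc[OF insert.hyps, of "d - 1"] by (cases d) auto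
    then show "fps_nth (?F (insert x S) * (1 - fps_X)) d = fps_nth (fps_X * ?F S) d"
      by (simp only: right_diff_distrib mult_1_right fps_sub_nth fps_X_mult_right_nth
          fps_X_mult_nth fps_nth_Abs_fps) simp
  qed
  then have "?F (insert x S) * (1 - fps_X) * (1 - fps_X) ^ card S = fps_X * ?F S * (1 - fps_X) ^ card S"
    by (rule arg_cong)
  also have "\<dots> = fps_X * fps_X ^ card S" by (simp only: mult.assoc insert.IH)
  finally show ?case using insert.hyps by (simp add: mult.assoc)
qed

section \<open>Stanley--Reisner ideals\<close>

lemma mpoly_ring_simps [simp]:
  "f \<otimes>\<^bsub>mpoly_ring V\<^esub> g = f * g" "f \<oplus>\<^bsub>mpoly_ring V\<^esub> g = f + g"
  "\<one>\<^bsub>mpoly_ring V\<^esub> = 1" "\<zero>\<^bsub>mpoly_ring V\<^esub> = 0"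
  by (simp_all add: mpoly_ring_def)

lemma in_mpoly_ring_iff:
  "f \<in> carrier (mpoly_ring V) \<longleftrightarrow> (\<forall>m\<in>Poly_Mapping.keys f. Poly_Mapping.keys m \<subseteq> V)"
  by (simp add: mpoly_ring_def)

lemma single_in_mpoly_ring [simp]:
  "Poly_Mapping.keys m \<subseteq> V \<Longrightarrow> Poly_Mapping.single m c \<in> carrier (mpoly_ring V)"
  by (simp add: in_mpoly_ring_iff)

lemma mconst_in_mpoly_ring [simp]: "mconst c \<in> carrier (mpoly_ring V)"
  by (simp add: mconst_def)

lemma mpoly_ring_uminus_closed: "f \<in> carrier (mpoly_ring V) \<Longrightarrow> - f \<in> carrier (mpoly_ring V)"
  by (simp add: in_mpoly_ring_iff)

lemma mpoly_ring_a_inv [simp]: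
  fixes f :: "('v, 'k::field) mpoly"
  assumes "f \<in> carrier (mpoly_ring V)"
  shows "\<ominus>\<^bsub>mpoly_ring V\<^esub> f = - f"
proof -
  interpret R: cring "mpoly_ring V :: ('v, 'k) mpoly ring" by (rule cring_mpoly_ring)
  show ?thesis using assms
    by (intro R.minus_equality) (auto simp: mpoly_ring_uminus_closed)
qed

lemma mpoly_ring_diff [simp]:
  fixes f g :: "('v, 'k::field) mpoly"
  assumes "g \<in> carrier (mpoly_ring V)"
  shows "f \<ominus>\<^bsub>mpoly_ring V\<^esub> g = f - g"
  using assms by (simp add: a_minus_def)

lemma mpoly_eq_sum_single: "f = (\<Sum>m\<in>Poly_Mapping.keys f. Poly_Mapping.single m (Poly_Mapping.lookup f m))"
  by (rule poly_mapping_eqI)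
     (simp add: lookup_sum lookup_single when_def not_in_keys_iff_lookup_eq_zero)

lemma mconst_mult_single: "mconst c * Poly_Mapping.single m d = Poly_Mapping.single m (c * d)"
  by (simp add: mconst_def mult_single)

lemma lookup_mconst_mult: "Poly_Mapping.lookup (mconst c * f) m = c * Poly_Mapping.lookup f m"
proof -
  have "mconst c * f = (\<Sum>n\<in>Poly_Mapping.keys f. Poly_Mapping.single n (c * Poly_Mapping.lookup f n))"
    by (subst mpoly_eq_sum_single[of f]) (simp add: sum_distrib_left mconst_mult_single)
  then show ?thesis
    by (simp add: lookup_sum lookup_single when_def not_in_keys_iff_lookup_eq_zero)
qed

definition restrict_keys :: "('a \<Rightarrow> bool) \<Rightarrow> ('a \<Rightarrow>\<^sub>0 'b::zero) \<Rightarrow> 'a \<Rightarrow>\<^sub>0 'b" where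
  "restrict_keys Q f = Poly_Mapping.mapp (\<lambda>m c. if Q m then c else 0) f"

lemma lookup_restrict_keys:
  "Poly_Mapping.lookup (restrict_keys Q f) m = (if Q m then Poly_Mapping.lookup f m else 0)"
  by (simp add: restrict_keys_def lookup_mapp when_def not_in_keys_iff_lookup_eq_zero)

lemma keys_restrict_keys: "Poly_Mapping.keys (restrict_keys Q f) = {m \<in> Poly_Mapping.keys f. Q m}"
  by (auto simp: in_keys_iff lookup_restrict_keys split: if_splits)

lemma keys_minus_restrict_keys:
  fixes f :: "'a \<Rightarrow>\<^sub>0 'b::cancel_comm_monoid_add"
  shows "Poly_Mapping.keys (f - restrict_keys Q f) = {m \<in> Poly_Mapping.keys f. \<not> Q m}"
  by (auto simp: in_keys_iff lookup_restrict_keys lookup_minus split: if_splits)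

text \<open>
  This is the usual ideal spanned by the monomials whose support is not a face. For \<open>\<Delta> = Pow S\<close> it is
  the prime ideal generated by the variables outside \<open>S\<close>.
\<close>

definition stanley_reisner_ideal :: "'v set \<Rightarrow> 'v set set \<Rightarrow> ('v, 'k::field) mpoly set" where
  "stanley_reisner_ideal V \<Delta> =
     {f \<in> carrier (mpoly_ring V). \<forall>m\<in>Poly_Mapping.keys f. Poly_Mapping.keys m \<notin> \<Delta>}"

lemma stanley_reisner_ideal_is_ideal:
  assumes down: "\<And>S T. S \<in> \<Delta> \<Longrightarrow> T \<subseteq> S \<Longrightarrow> T \<in> \<Delta>"
  shows "ideal (stanley_reisner_ideal V \<Delta> :: ('v, 'k::field) mpoly set) (mpoly_ring V)"
    (is "ideal ?I ?R")
proof -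
  interpret R: cring "mpoly_ring V :: ('v, 'k) mpoly ring" by (rule cring_mpoly_ring)
  have mult: "f * g \<in> ?I" if f: "f \<in> ?I" and g: "g \<in> carrier ?R" for f g
  proof -
    have "Poly_Mapping.keys m \<notin> \<Delta>" if "m \<in> Poly_Mapping.keys (f * g)" for m
    proof -
      obtain a b where ab: "a \<in> Poly_Mapping.keys f" "m = a + b"
        using \<open>m \<in> Poly_Mapping.keys (f * g)\<close> keys_mult[of f g] by blast
      then have "Poly_Mapping.keys a \<notin> \<Delta>" using f by (auto simp: stanley_reisner_ideal_def)
      then show ?thesis using down[of "Poly_Mapping.keys m" "Poly_Mapping.keys a"] ab(2)
        by (auto simp: keys_add_monomial)
    qed
    moreover have "f * g \<in> carrier ?R"
      using R.m_closed[of f g] f g by (simp add: stanley_reisner_ideal_def)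
    ultimately show ?thesis by (simp add: stanley_reisner_ideal_def)
  qed
  have add: "f + g \<in> ?I" if "f \<in> ?I" "g \<in> ?I" for f g
    using that Poly_Mapping.keys_add[of f g] R.a_closed[of f g]
    by (auto simp: stanley_reisner_ideal_def)
  have "subgroup ?I (add_monoid ?R)"
  proof (rule R.add.subgroupI)
    show "?I \<subseteq> carrier ?R" by (auto simp: stanley_reisner_ideal_def)
    have "0 \<in> ?I" by (simp add: stanley_reisner_ideal_def in_mpoly_ring_iff)
    then show "?I \<noteq> {}" by blast
    show "\<ominus>\<^bsub>?R\<^esub> f \<in> ?I" if "f \<in> ?I" for f
      using that by (simp add: stanley_reisner_ideal_def mpoly_ring_uminus_closed)
    show "f \<oplus>\<^bsub>?R\<^esub> g \<in> ?I" if "f \<in> ?I" "g \<in> ?I" for f g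
      using add[OF that] by simp
  qed
  then show ?thesis
  proof (rule idealI[OF R.ring_axioms])
    fix f g assume "f \<in> ?I" "g \<in> carrier ?R"
    from mult[OF this] show "g \<otimes>\<^bsub>?R\<^esub> f \<in> ?I" "f \<otimes>\<^bsub>?R\<^esub> g \<in> ?I"
      by (simp_all add: mult.commute)
  qed
qed

lemma ideal_diff_closed:
  fixes f g :: "('v, 'k::field) mpoly"
  assumes "ideal I (mpoly_ring V)" "f \<in> I" "g \<in> I"
  shows "f - g \<in> I"
proof -
  interpret ideal I "mpoly_ring V" by fact
  have "- 1 \<in> carrier (mpoly_ring V :: ('v, 'k) mpoly ring)" by (simp add: in_mpoly_ring_iff)
  from I_l_closed[OF assms(3) this] have "- g \<in> I" by simp
  from additive_subgroup.a_closed[OF is_additive_subgroup assms(2) this] show ?thesis by simp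
qed

lemma coset_eq_iff:
  fixes f g :: "('v, 'k::field) mpoly"
  assumes "ideal I (mpoly_ring V)" "f \<in> carrier (mpoly_ring V)" "g \<in> carrier (mpoly_ring V)"
  shows "I +>\<^bsub>mpoly_ring V\<^esub> f = I +>\<^bsub>mpoly_ring V\<^esub> g \<longleftrightarrow> f - g \<in> I"
proof -
  interpret R: cring "mpoly_ring V :: ('v, 'k) mpoly ring" by (rule cring_mpoly_ring)
  show ?thesis using R.quotient_eq_iff_same_a_r_cos[OF assms] assms(3) by simp
qed

lemma subfield_constants: "subfield (range mconst :: ('v, 'k::field) mpoly set) (mpoly_ring V)"
proof -
  let ?R = "mpoly_ring V :: ('v, 'k) mpoly ring" and ?K = "range mconst :: ('v, 'k) mpoly set"
  interpret R: cring ?R by (rule cring_mpoly_ring)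
  have mult: "mconst a * mconst b = (mconst (a * b) :: ('v, 'k) mpoly)"
    and one: "(1 :: ('v, 'k) mpoly) = mconst 1" and zero: "(0 :: ('v, 'k) mpoly) = mconst 0" for a b
    by (simp_all add: mconst_def mult_single)
  have "subring ?K ?R"
    by (rule R.subringI) (auto simp: mconst_def mult_single simp flip: single_add single_uminus single_one)
  then show ?thesis
  proof (intro R.subfieldI R.subcringI')
    show "Units (?R\<lparr>carrier := ?K\<rparr>) = ?K - {\<zero>\<^bsub>?R\<^esub>}"
    proof (intro equalityI subsetI)
      fix x assume "x \<in> Units (?R\<lparr>carrier := ?K\<rparr>)"
      then show "x \<in> ?K - {\<zero>\<^bsub>?R\<^esub>}" by (auto simp: Units_def)
    next
      fix x assume "x \<in> ?K - {\<zero>\<^bsub>?R\<^esub>}"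
      then obtain c where c: "x = mconst c" "c \<noteq> 0" by (auto simp: zero)
      then have "mconst (inverse c) * x = 1" "x * mconst (inverse c) = 1"
        by (simp_all add: mult one)
      then show "x \<in> Units (?R\<lparr>carrier := ?K\<rparr>)" using c(1) by (auto simp: Units_def)
    qed
  qed
qed

section \<open>The Hilbert series of a Stanley--Reisner ring\<close>

locale simplicial_complex =
  fixes V :: "'v set" and \<Delta> :: "'v set set"
  assumes finite_vertices: "finite V"
    and face_subset: "S \<in> \<Delta> \<Longrightarrow> S \<subseteq> V"
    and empty_face: "{} \<in> \<Delta>"
    and down_closed: "S \<in> \<Delta> \<Longrightarrow> T \<subseteq> S \<Longrightarrow> T \<in> \<Delta>"
begin

lemma finite_faces: "finite \<Delta>"
  by (rule finite_subset[of _ "Pow V"]) (use finite_vertices face_subset in auto)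

lemma finite_face: "S \<in> \<Delta> \<Longrightarrow> finite S"
  using face_subset finite_vertices finite_subset by blast

definition max_face_card :: nat where
  "max_face_card = Max (card ` \<Delta>)"

lemma card_face_le: "S \<in> \<Delta> \<Longrightarrow> card S \<le> max_face_card"
  unfolding max_face_card_def using finite_faces by (intro Max_ge) auto

lemma obtain_facet: obtains F where "F \<in> \<Delta>" "card F = max_face_card"
proof -
  have "max_face_card \<in> card ` \<Delta>"
    unfolding max_face_card_def using finite_faces empty_face by (intro Max_in) auto
  then show ?thesis using that by auto
qed

lemmas sr_ideal = stanley_reisner_ideal_is_ideal[of \<Delta> V, OF down_closed]

text \<open>
  Distinct monomials supported on faces stay linearly independent modulo the ideal, because every
  element of the ideal avoids all of them. Adding them one at a time fits the inductive definition of
  dimension.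
\<close>

lemma dimension_monomial_span:
  fixes I :: "('v, 'k::field) mpoly set"
  assumes I: "I = stanley_reisner_ideal V \<Delta>"
    and "finite M" "\<And>m. m \<in> M \<Longrightarrow> Poly_Mapping.keys m \<in> \<Delta>"
  shows "ring.dimension (mpoly_ring V Quot I) (card M)
           ((\<lambda>c. I +>\<^bsub>mpoly_ring V\<^esub> mconst c) ` UNIV)
           ((\<lambda>f. I +>\<^bsub>mpoly_ring V\<^esub> f) ` {f. Poly_Mapping.keys f \<subseteq> M})"
proof -
  let ?R = "mpoly_ring V :: ('v, 'k) mpoly ring"
  let ?K = "(\<lambda>c. I +>\<^bsub>?R\<^esub> mconst c) ` UNIV"
  let ?h = "\<lambda>f. I +>\<^bsub>?R\<^esub> f"
  have ideal: "ideal I ?R" unfolding I by (rule sr_ideal)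
  interpret h: ring_hom_ring ?R "?R Quot I" ?h
    by (rule ideal.rcos_ring_hom_ring[OF ideal])
  from assms(2,3) show ?thesis
  proof (induction M)
    case empty
    have "?h ` {f. Poly_Mapping.keys f \<subseteq> {}} = {\<zero>\<^bsub>?R Quot I\<^esub>}"
      using h.hom_zero by simp
    then show ?case by simp
  next
    case (insert m M)
    let ?E = "\<lambda>M. ?h ` {f. Poly_Mapping.keys f \<subseteq> M}"
    let ?m = "Poly_Mapping.single m 1 :: ('v, 'k) mpoly"
    have carr: "f \<in> carrier ?R" if "Poly_Mapping.keys f \<subseteq> insert m M" for f
      using that insert.prems face_subset by (fastforce simp: in_mpoly_ring_iff)
    have m: "?m \<in> carrier ?R" by (rule carr) simp
    have notin: "?h ?m \<notin> ?E M"
    proof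
      assume "?h ?m \<in> ?E M"
      then obtain e where e: "Poly_Mapping.keys e \<subseteq> M" "?h ?m = ?h e" by auto
      have "e \<in> carrier ?R" using e(1) by (intro carr) auto
      then have "?m - e \<in> I" using e(2) coset_eq_iff[OF ideal m] by simp
      moreover have "m \<in> Poly_Mapping.keys (?m - e)"
      proof -
        have "Poly_Mapping.lookup e m = 0"
          using e(1) insert.hyps(2) not_in_keys_iff_lookup_eq_zero[of m e] by blast
        then show ?thesis by (simp add: in_keys_iff lookup_minus)
      qed
      ultimately show False using insert.prems[of m] by (auto simp: I stanley_reisner_ideal_def)
    qed
    have comb: "?h (mconst c * ?m + e) = ?h (mconst c) \<otimes>\<^bsub>?R Quot I\<^esub> ?h ?m \<oplus>\<^bsub>?R Quot I\<^esub> ?h e"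
      if "Poly_Mapping.keys e \<subseteq> M" for c e
    proof -
      have e: "e \<in> carrier ?R" using that by (intro carr) auto
      have "?h (mconst c * ?m + e) = ?h ((mconst c \<otimes>\<^bsub>?R\<^esub> ?m) \<oplus>\<^bsub>?R\<^esub> e)" by simp
      also have "\<dots> = ?h (mconst c) \<otimes>\<^bsub>?R Quot I\<^esub> ?h ?m \<oplus>\<^bsub>?R Quot I\<^esub> ?h e"
        using e m by (simp only: h.hom_add h.hom_mult h.R.m_closed mconst_in_mpoly_ring)
      finally show ?thesis .
    qed
    have "ring.line_extension (?R Quot I) ?K (?h ?m) (?E M) = ?E (insert m M)"
    proof (intro equalityI subsetI)
      fix x assume "x \<in> ring.line_extension (?R Quot I) ?K (?h ?m) (?E M)"
      then obtain c e where x: "Poly_Mapping.keys e \<subseteq> M"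
          "x = ?h (mconst c) \<otimes>\<^bsub>?R Quot I\<^esub> ?h ?m \<oplus>\<^bsub>?R Quot I\<^esub> ?h e"
        unfolding h.S.line_extension_def set_add_def' r_coset_def by auto
      have "Poly_Mapping.keys (mconst c * ?m + e) \<subseteq> insert m M"
        using Poly_Mapping.keys_add[of "mconst c * ?m" e] x(1)
        by (auto simp: mconst_mult_single split: if_splits)
      then show "x \<in> ?E (insert m M)" using comb[OF x(1)] x(2) by (metis (mono_tags) image_eqI mem_Collect_eq)
    next
      fix x assume "x \<in> ?E (insert m M)"
      then obtain f where f: "Poly_Mapping.keys f \<subseteq> insert m M" "x = ?h f" by auto
      define e where "e = restrict_keys (\<lambda>n. n \<noteq> m) f"
      have e: "Poly_Mapping.keys e \<subseteq> M" using f(1) by (auto simp: e_def keys_restrict_keys)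
      have "f = mconst (Poly_Mapping.lookup f m) * ?m + e"
        by (rule poly_mapping_eqI)
          (auto simp: e_def lookup_add lookup_restrict_keys mconst_mult_single lookup_single when_def)
      then have "x = ?h (mconst (Poly_Mapping.lookup f m)) \<otimes>\<^bsub>?R Quot I\<^esub> ?h ?m \<oplus>\<^bsub>?R Quot I\<^esub> ?h e"
        using comb[OF e] f(2) by metis
      then show "x \<in> ring.line_extension (?R Quot I) ?K (?h ?m) (?E M)"
        unfolding h.S.line_extension_def set_add_def' r_coset_def using e by auto
    qed
    moreover have "h.S.dimension (Suc (card M)) ?K (ring.line_extension (?R Quot I) ?K (?h ?m) (?E M))"
      by (rule h.S.dimension.Suc_dim) (use h.hom_closed[OF m] notin insert in auto)
    ultimately show ?case using insert.hyps by simp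
  qed
qed

lemma dim_homogeneous_part:
  fixes I :: "('v, 'k::field) mpoly set"
  assumes I: "I = stanley_reisner_ideal V \<Delta>"
  shows "ring.dim (mpoly_ring V Quot I) ((\<lambda>c. I +>\<^bsub>mpoly_ring V\<^esub> mconst c) ` UNIV)
           ((\<lambda>f. I +>\<^bsub>mpoly_ring V\<^esub> f) ` homogeneous_part V d)
         = (\<Sum>S\<in>\<Delta>. card (monomials_of_support S d))"
proof -
  let ?R = "mpoly_ring V :: ('v, 'k) mpoly ring"
  let ?K = "(\<lambda>c. I +>\<^bsub>?R\<^esub> mconst c) ` UNIV"
  let ?h = "\<lambda>f. I +>\<^bsub>?R\<^esub> f"
  have ideal: "ideal I ?R" unfolding I by (rule sr_ideal)
  interpret h: ring_hom_ring ?R "?R Quot I" ?h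
    by (rule ideal.rcos_ring_hom_ring[OF ideal])
  define M where "M = (\<Union>S\<in>\<Delta>. monomials_of_support S d)"
  have finM: "finite M"
    unfolding M_def using finite_faces finite_face by (auto intro: finite_monomials_of_support)
  have memM: "m \<in> M \<longleftrightarrow> Poly_Mapping.keys m \<in> \<Delta> \<and> monomial_degree m = d" for m
    by (auto simp: M_def monomials_of_support_def)
  have "?h ` homogeneous_part V d = ?h ` {f. Poly_Mapping.keys f \<subseteq> M}"
  proof (intro equalityI image_subsetI)
    fix f :: "('v, 'k) mpoly" assume f: "f \<in> homogeneous_part V d"
    define e where "e = restrict_keys (\<lambda>m. m \<in> M) f"
    have fc: "f \<in> carrier ?R" using f by (simp add: homogeneous_part_def)
    have ec: "e \<in> carrier ?R" using fc by (simp add: e_def in_mpoly_ring_iff keys_restrict_keys)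
    have "f - e \<in> I" using f
      by (auto simp: I stanley_reisner_ideal_def e_def in_mpoly_ring_iff keys_minus_restrict_keys
          homogeneous_part_def memM)
    then have "?h f = ?h e" using coset_eq_iff[OF ideal fc ec] by simp
    moreover have "Poly_Mapping.keys e \<subseteq> M" by (auto simp: e_def keys_restrict_keys)
    ultimately show "?h f \<in> ?h ` {f. Poly_Mapping.keys f \<subseteq> M}" by blast
  next
    fix f :: "('v, 'k) mpoly" assume "f \<in> {f. Poly_Mapping.keys f \<subseteq> M}"
    then have "f \<in> homogeneous_part V d"
      using memM face_subset by (fastforce simp: homogeneous_part_def in_mpoly_ring_iff)
    then show "?h f \<in> ?h ` homogeneous_part V d" by blast
  qed
  then have dim: "h.S.dimension (card M) ?K (?h ` homogeneous_part V d)"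
    using dimension_monomial_span[OF I finM] memM by simp
  have "(1 :: ('v, 'k) mpoly) \<notin> I"
    using empty_face by (simp add: I stanley_reisner_ideal_def)
  then have "?h 1 \<noteq> ?h 0"
    using coset_eq_iff[OF ideal, of 1 0] h.R.one_closed h.R.zero_closed by simp
  then have one: "\<one>\<^bsub>?R Quot I\<^esub> \<noteq> \<zero>\<^bsub>?R Quot I\<^esub>"
    using h.hom_one h.hom_zero by simp
  have K: "?K = ?h ` range mconst" by auto
  have "subfield ?K (?R Quot I)"
    unfolding K by (rule h.img_is_subfield(2)[OF subfield_constants one])
  from h.S.dimI[OF this dim] have "h.S.dim ?K (?h ` homogeneous_part V d) = card M"
    by (simp add: over_def)
  also have "card M = (\<Sum>S\<in>\<Delta>. card (monomials_of_support S d))"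
    unfolding M_def using finite_faces finite_face
    by (intro card_UN_disjoint) (auto simp: monomials_of_support_def intro: finite_monomials_of_support[unfolded monomials_of_support_def])
  finally show ?thesis .
qed

text \<open>
  Its coefficients are the \<open>h\<close>-vector of the complex.
\<close>

definition h_vector_poly :: "int poly" where
  "h_vector_poly = (\<Sum>S\<in>\<Delta>. [:0, 1:] ^ card S * [:1, - 1:] ^ (max_face_card - card S))"

lemma hilbert_series_mult:
  fixes I :: "('v, 'k::field) mpoly set"
  assumes I: "I = stanley_reisner_ideal V \<Delta>"
  shows "hilbert_series (mpoly_ring V Quot I) ((\<lambda>c. I +>\<^bsub>mpoly_ring V\<^esub> mconst c) ` UNIV)
           (\<lambda>d. (\<lambda>f. I +>\<^bsub>mpoly_ring V\<^esub> f) ` homogeneous_part V d) * (1 - fps_X) ^ max_face_card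
         = fps_of_poly h_vector_poly"
proof -
  let ?F = "\<lambda>S. Abs_fps (\<lambda>d. int (card (monomials_of_support S d)))"
  have "hilbert_series (mpoly_ring V Quot I) ((\<lambda>c. I +>\<^bsub>mpoly_ring V\<^esub> mconst c) ` UNIV)
           (\<lambda>d. (\<lambda>f. I +>\<^bsub>mpoly_ring V\<^esub> f) ` homogeneous_part V d) = (\<Sum>S\<in>\<Delta>. ?F S)"
    unfolding hilbert_series_def dim_homogeneous_part[OF I] by (rule fps_ext) (simp add: fps_sum_nth)
  also have "\<dots> * (1 - fps_X) ^ max_face_card
      = (\<Sum>S\<in>\<Delta>. fps_X ^ card S * (1 - fps_X) ^ (max_face_card - card S))"
    unfolding sum_distrib_right
  proof (rule sum.cong)
    fix S assume S: "S \<in> \<Delta>"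
    have "?F S * (1 - fps_X) ^ max_face_card
        = ?F S * (1 - fps_X) ^ card S * (1 - fps_X) ^ (max_face_card - card S)"
      using card_face_le[OF S] by (simp add: mult.assoc flip: power_add)
    then show "?F S * (1 - fps_X) ^ max_face_card
        = fps_X ^ card S * (1 - fps_X) ^ (max_face_card - card S)"
      by (simp only: monomials_of_support_series[OF finite_face[OF S]])
  qed simp
  also have "\<dots> = fps_of_poly h_vector_poly"
  proof -
    have X: "fps_of_poly [:0, 1:] = (fps_X :: int fps)" by (simp add: fps_of_poly_pCons)
    have X1: "fps_of_poly [:1, - 1:] = (1 - fps_X :: int fps)"
      by (simp add: fps_of_poly_pCons fps_const_neg[symmetric])
    show ?thesis
      unfolding h_vector_poly_def by (simp only: fps_of_poly_sum fps_of_poly_mult fps_of_poly_power X X1)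
  qed
  finally show ?thesis .
qed

end

section \<open>Monomials along a chain of prime ideals\<close>

lemma mpoly_ring_closed:
  fixes f g :: "('v, 'k::field) mpoly"
  assumes "f \<in> carrier (mpoly_ring V)" "g \<in> carrier (mpoly_ring V)"
  shows "f + g \<in> carrier (mpoly_ring V)" "f * g \<in> carrier (mpoly_ring V)"
proof -
  interpret R: cring "mpoly_ring V :: ('v, 'k) mpoly ring" by (rule cring_mpoly_ring)
  show "f + g \<in> carrier (mpoly_ring V)" "f * g \<in> carrier (mpoly_ring V)"
    using R.a_closed[OF assms] R.m_closed[OF assms] by simp_all
qed

lemma one_zero_in_mpoly_ring [simp]:
  "1 \<in> carrier (mpoly_ring V)" "0 \<in> carrier (mpoly_ring V)"
  by (simp_all add: in_mpoly_ring_iff)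

lemma mpoly_ring_power_closed:
  "f \<in> carrier (mpoly_ring V) \<Longrightarrow> f ^ n \<in> carrier (mpoly_ring V)"
  by (induction n) (simp_all add: mpoly_ring_closed)

lemma mpoly_ring_prod_closed:
  "(\<And>i. i \<in> A \<Longrightarrow> f i \<in> carrier (mpoly_ring V)) \<Longrightarrow> prod f A \<in> carrier (mpoly_ring V)"
  by (induction A rule: infinite_finite_induct) (simp_all add: mpoly_ring_closed)

lemma mpoly_ring_sum_closed:
  "(\<And>i. i \<in> A \<Longrightarrow> f i \<in> carrier (mpoly_ring V)) \<Longrightarrow> sum f A \<in> carrier (mpoly_ring V)"
  by (induction A rule: infinite_finite_induct) (simp_all add: mpoly_ring_closed)

lemma ideal_mult_closed:
  fixes f g :: "('v, 'k::field) mpoly"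
  assumes "ideal I (mpoly_ring V)" "f \<in> I" "g \<in> carrier (mpoly_ring V)"
  shows "g * f \<in> I"
  using ideal.I_l_closed[OF assms] by simp

lemma ideal_sum_closed:
  fixes f :: "'i \<Rightarrow> ('v, 'k::field) mpoly"
  assumes "ideal I (mpoly_ring V)"
  shows "(\<And>i. i \<in> A \<Longrightarrow> f i \<in> I) \<Longrightarrow> sum f A \<in> I"
proof (induction A rule: infinite_finite_induct)
  case (insert x A)
  have "f x \<oplus>\<^bsub>mpoly_ring V\<^esub> sum f A \<in> I"
    by (rule additive_subgroup.a_closed[OF ideal.axioms(1)[OF assms]]) (use insert in auto)
  then show ?case using insert.hyps by simp
qed (use additive_subgroup.zero_closed[OF ideal.axioms(1)[OF assms]] in auto)

lemma primeideal_power_notin: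
  fixes f :: "('v, 'k::field) mpoly"
  assumes "primeideal P (mpoly_ring V)" "f \<in> carrier (mpoly_ring V)" "f \<notin> P"
  shows "f ^ n \<notin> P"
proof (induction n)
  case 0
  then show ?case
    using primeideal.I_notcarr[OF assms(1)] ideal.one_imp_carrier[OF primeideal.axioms(1)[OF assms(1)]]
    by auto
next
  case (Suc n)
  then show ?case
    using primeideal.I_prime[OF assms(1,2) mpoly_ring_power_closed[OF assms(2)], of n] assms(3) by auto
qed

lemma constant_notin_primeideal:
  fixes P :: "('v, 'k::field) mpoly set"
  assumes P: "primeideal P (mpoly_ring V)" and "mconst c \<in> P"
  shows "c = 0"
proof (rule ccontr)
  assume "c \<noteq> 0"
  have "mconst (inverse c) * mconst c \<in> P"
    by (rule ideal_mult_closed[OF primeideal.axioms(1)[OF P] assms(2)]) simp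
  then have "1 \<in> P" using \<open>c \<noteq> 0\<close> by (simp add: mconst_def mult_single)
  then show False using primeideal_power_notin[OF P, of 1 0] primeideal.I_notcarr[OF P]
      ideal.one_imp_carrier[OF primeideal.axioms(1)[OF P]] by simp
qed

text \<open>
  A strict chain of \<open>n + 1\<close> primes yields \<open>n\<close> elements that are algebraically independent modulo the
  smallest one, which reduces bounding the length of chains to counting monomials. Given a
  relation in \<open>P i\<close>, divide it by the highest power of \<open>a i\<close> common to all terms, which is allowed as
  \<open>P i\<close> is prime and \<open>a i \<notin> P i\<close>. Reducing modulo \<open>P (Suc i)\<close>, which contains \<open>a i\<close>, leaves exactly
  the terms with the least exponent of \<open>a i\<close>: a relation in the remaining elements. At the end of the
  chain it is a nonzero constant in a prime ideal.
\<close>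

lemma prime_chain_monomials_independent:
  fixes P :: "nat \<Rightarrow> ('v, 'k::field) mpoly set" and a :: "nat \<Rightarrow> ('v, 'k) mpoly"
    and c :: "(nat \<Rightarrow> nat) \<Rightarrow> 'k"
  assumes prime: "\<And>i. i \<le> n \<Longrightarrow> primeideal (P i) (mpoly_ring V)"
    and chain: "\<And>i. i < n \<Longrightarrow> P i \<subseteq> P (Suc i)"
    and a: "\<And>i. i < n \<Longrightarrow> a i \<in> P (Suc i)" "\<And>i. i < n \<Longrightarrow> a i \<notin> P i"
    and "i \<le> n" "finite E"
    and distinct: "\<And>e e'. e \<in> E \<Longrightarrow> e' \<in> E \<Longrightarrow> (\<And>j. i \<le> j \<Longrightarrow> j < n \<Longrightarrow> e j = e' j) \<Longrightarrow> e = e'"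
    and rel: "(\<Sum>e\<in>E. mconst (c e) * (\<Prod>j\<in>{i..<n}. a j ^ e j)) \<in> P i"
  shows "\<forall>e\<in>E. c e = 0"
  using assms(5-)
proof (induction i arbitrary: E rule: inc_induct)
  case base
  show ?case
  proof
    fix e assume "e \<in> E"
    with base have "E = {e}" by force
    with base have "mconst (c e) \<in> P n" by simp
    then show "c e = 0" by (rule constant_notin_primeideal[OF prime[OF order_refl]])
  qed
next
  case (step i)
  have ac: "a j \<in> carrier (mpoly_ring V)" if "j < n" for j
    using a(1)[OF that] prime[of "Suc j"] that
    by (auto dest: primeideal.axioms(1) intro: ideal.Icarr)
  have idl: "ideal (P (Suc i)) (mpoly_ring V)" "ideal (P i) (mpoly_ring V)"
    using prime[of "Suc i"] prime[of i] step.hyps by (auto dest: primeideal.axioms(1))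
  define rest where "rest e = (\<Prod>j\<in>{Suc i..<n}. a j ^ e j)" for e
  have restc: "rest e \<in> carrier (mpoly_ring V)" for e
    unfolding rest_def using ac by (intro mpoly_ring_prod_closed mpoly_ring_power_closed) auto
  have split: "(\<Prod>j\<in>{i..<n}. a j ^ e j) = a i ^ e i * rest e" for e
    using step.hyps by (simp add: rest_def prod.atLeast_Suc_lessThan)
  define E' where "E' = {e \<in> E. c e \<noteq> 0}"
  show ?case
  proof (rule ccontr)
    assume "\<not> (\<forall>e\<in>E. c e = 0)"
    then have ne: "E' \<noteq> {}" by (auto simp: E'_def)
    have fin: "finite E'" using step.prems(1) by (simp add: E'_def)
    \<comment> \<open>The power of \<open>a i\<close> that divides every term with a nonzero coefficient.\<close>
    define m where "m = Min ((\<lambda>e. e i) ` E')"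
    have m_le: "m \<le> e i" if "e \<in> E'" for e
      unfolding m_def using fin that by (intro Min_le) auto
    have "m \<in> (\<lambda>e. e i) ` E'" unfolding m_def using fin ne by (intro Min_in) auto
    then obtain e0 where e0: "e0 \<in> E'" "e0 i = m" by auto
    define T where "T e = mconst (c e) * (a i ^ (e i - m) * rest e)" for e
    have Tc: "T e \<in> carrier (mpoly_ring V)" for e
      unfolding T_def using ac step.hyps restc
      by (intro mpoly_ring_closed mpoly_ring_power_closed mconst_in_mpoly_ring) auto
    have "(\<Sum>e\<in>E. mconst (c e) * (\<Prod>j\<in>{i..<n}. a j ^ e j)) = (\<Sum>e\<in>E'. a i ^ m * T e)"
    proof (rule sum.mono_neutral_cong_right)
      show "\<forall>e\<in>E - E'. mconst (c e) * (\<Prod>j\<in>{i..<n}. a j ^ e j) = 0"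
        by (auto simp: E'_def mconst_def)
      fix e assume "e \<in> E'"
      then have "a i ^ e i = a i ^ m * a i ^ (e i - m)" using m_le by (simp flip: power_add)
      then show "mconst (c e) * (\<Prod>j\<in>{i..<n}. a j ^ e j) = a i ^ m * T e"
        by (simp add: split T_def mult_ac)
    qed (auto simp: E'_def step.prems(1))
    also have "\<dots> = a i ^ m * sum T E'" by (simp add: sum_distrib_left)
    finally have "a i ^ m \<otimes>\<^bsub>mpoly_ring V\<^esub> sum T E' \<in> P i" using step.prems(3) by simp
    moreover have "a i ^ m \<notin> P i"
      using step.hyps prime[of i] ac a(2) by (intro primeideal_power_notin) auto
    ultimately have "sum T E' \<in> P i"
      using primeideal.I_prime[OF prime[of i], of "a i ^ m" "sum T E'"] step.hyps ac Tc
      by (auto intro: mpoly_ring_power_closed mpoly_ring_sum_closed)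
    then have 1: "sum T E' \<in> P (Suc i)" using chain step.hyps by auto
    define E0 where "E0 = {e \<in> E'. e i = m}"
    have 2: "sum T (E' - E0) \<in> P (Suc i)"
    proof (rule ideal_sum_closed[OF idl(1)])
      fix e assume "e \<in> E' - E0"
      then have "e i - m = Suc (e i - m - 1)" using m_le[of e] by (auto simp: E0_def)
      then have pow: "a i ^ (e i - m) = a i * a i ^ (e i - m - 1)" by (metis power_Suc)
      have "T e = (mconst (c e) * (a i ^ (e i - m - 1) * rest e)) * a i"
        unfolding T_def pow by (simp only: mult_ac)
      also have "\<dots> \<in> P (Suc i)"
        using ac step.hyps restc a(1)
        by (intro ideal_mult_closed[OF idl(1)] mpoly_ring_closed mpoly_ring_power_closed
            mconst_in_mpoly_ring) auto
      finally show "T e \<in> P (Suc i)" .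
    qed
    have "sum T E' = sum T (E' - E0) + sum T E0"
      using fin by (intro sum.subset_diff) (auto simp: E0_def)
    then have "sum T E0 = sum T E' - sum T (E' - E0)" by simp
    also have "\<dots> \<in> P (Suc i)" by (rule ideal_diff_closed[OF idl(1) 1 2])
    also have "sum T E0 = (\<Sum>e\<in>E0. mconst (c e) * (\<Prod>j\<in>{Suc i..<n}. a j ^ e j))"
      by (intro sum.cong) (auto simp: E0_def T_def rest_def)
    finally have rel0: "(\<Sum>e\<in>E0. mconst (c e) * (\<Prod>j\<in>{Suc i..<n}. a j ^ e j)) \<in> P (Suc i)" .
    have "\<forall>e\<in>E0. c e = 0"
    proof (rule step.IH[OF _ _ rel0])
      show "finite E0" using fin by (simp add: E0_def)
      fix e e' assume e: "e \<in> E0" "e' \<in> E0" and eq: "\<And>j. Suc i \<le> j \<Longrightarrow> j < n \<Longrightarrow> e j = e' j"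
      show "e = e'"
      proof (rule step.prems(2))
        show "e j = e' j" if "i \<le> j" "j < n" for j
          using that eq[of j] e by (cases "j = i") (auto simp: E0_def)
      qed (use e in \<open>auto simp: E0_def E'_def\<close>)
    qed
    then show False using e0 by (auto simp: E0_def E'_def)
  qed
qed

text \<open>
  Gaussian elimination: an equation with a nonzero coefficient at \<open>p\<close> eliminates the unknown \<open>p\<close>.
\<close>

lemma homogeneous_linear_system_nontrivial_solution:
  fixes A :: "'e \<Rightarrow> 'm \<Rightarrow> 'k::field"
  assumes "finite M" "finite E" "card M < card E"
  shows "\<exists>x. (\<exists>e\<in>E. x e \<noteq> 0) \<and> (\<forall>m\<in>M. (\<Sum>e\<in>E. x e * A e m) = 0)"
  using assms
proof (induction M arbitrary: E A rule: finite_induct)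
  case empty
  then have "E \<noteq> {}" by auto
  then show ?case by (intro exI[of _ "\<lambda>_. 1"]) auto
next
  case (insert m M)
  show ?case
  proof (cases "\<forall>e\<in>E. A e m = 0")
    case True
    have "card M < card E" using insert.prems insert.hyps by simp
    from insert.IH[OF insert.prems(1) this, of A] True show ?thesis by auto
  next
    case False
    then obtain p where p: "p \<in> E" "A p m \<noteq> 0" by auto
    define E' where "E' = E - {p}"
    have E: "E = insert p E'" "p \<notin> E'" "finite E'" using p insert.prems by (auto simp: E'_def)
    have "card M < card E'" using insert.prems insert.hyps E by simp
    from insert.IH[OF E(3) this, of "\<lambda>e k. A e k - A e m / A p m * A p k"]
    obtain x where x: "\<exists>e\<in>E'. x e \<noteq> 0"
      "\<And>k. k \<in> M \<Longrightarrow> (\<Sum>e\<in>E'. x e * (A e k - A e m / A p m * A p k)) = 0" by blast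
    define s where "s = - (\<Sum>e\<in>E'. x e * A e m) / A p m"
    define y where "y = x(p := s)"
    have sum: "(\<Sum>e\<in>E. y e * A e k) = s * A p k + (\<Sum>e\<in>E'. x e * A e k)" for k
    proof -
      have "(\<Sum>e\<in>E'. y e * A e k) = (\<Sum>e\<in>E'. x e * A e k)"
        using E(2) by (intro sum.cong) (auto simp: y_def)
      then show ?thesis using E by (simp add: y_def)
    qed
    have "(\<Sum>e\<in>E. y e * A e k) = 0" if "k \<in> insert m M" for k
    proof (cases "k = m")
      case True
      then show ?thesis using p(2) by (simp add: sum s_def)
    next
      case False
      then have "(\<Sum>e\<in>E'. x e * (A e k - A e m / A p m * A p k)) = 0" using x(2) that by simp
      moreover have "(\<Sum>e\<in>E'. x e * (A e k - A e m / A p m * A p k))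
          = (\<Sum>e\<in>E'. x e * A e k) - (\<Sum>e\<in>E'. x e * A e m) / A p m * A p k"
        by (simp add: right_diff_distrib sum_subtractf sum_divide_distrib sum_distrib_right mult.assoc)
      ultimately show ?thesis by (simp add: sum s_def)
    qed
    moreover have "\<exists>e\<in>E. y e \<noteq> 0" using x(1) E by (auto simp: y_def)
    ultimately show ?thesis by blast
  qed
qed

section \<open>Coordinate prime ideals\<close>

definition exponents_bounded :: "('v, 'k::field) mpoly \<Rightarrow> nat \<Rightarrow> bool" where
  "exponents_bounded f b \<longleftrightarrow> (\<forall>m\<in>Poly_Mapping.keys f. \<forall>v. Poly_Mapping.lookup m v \<le> b)"

lemma exponents_bounded_mult:
  assumes "exponents_bounded f b" "exponents_bounded g c"
  shows "exponents_bounded (f * g) (b + c)"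
  unfolding exponents_bounded_def
proof (intro ballI allI)
  fix m v assume "m \<in> Poly_Mapping.keys (f * g)"
  then obtain p q where "p \<in> Poly_Mapping.keys f" "q \<in> Poly_Mapping.keys g" "m = p + q"
    using keys_mult[of f g] by blast
  then show "Poly_Mapping.lookup m v \<le> b + c"
    using assms by (auto simp: exponents_bounded_def lookup_add intro: add_mono)
qed

lemma exponents_bounded_one: "exponents_bounded 1 0"
  by (simp add: exponents_bounded_def)

lemma exponents_bounded_mono: "exponents_bounded f b \<Longrightarrow> b \<le> c \<Longrightarrow> exponents_bounded f c"
  unfolding exponents_bounded_def by (meson order.trans)

lemma exponents_bounded_power:
  "exponents_bounded f b \<Longrightarrow> exponents_bounded (f ^ n) (n * b)"
  by (induction n) (auto simp: exponents_bounded_one intro: exponents_bounded_mult)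

lemma exponents_bounded_prod:
  "(\<And>i. i \<in> A \<Longrightarrow> exponents_bounded (f i) b) \<Longrightarrow> finite A \<Longrightarrow> exponents_bounded (prod f A) (card A * b)"
  by (induction A rule: infinite_finite_induct)
     (auto simp: exponents_bounded_one intro: exponents_bounded_mult)

lemma ex_exponents_bounded: "\<exists>b. exponents_bounded f b"
proof
  show "exponents_bounded f (\<Sum>m\<in>Poly_Mapping.keys f. monomial_degree m)"
    unfolding exponents_bounded_def
  proof (intro ballI allI)
    fix m v assume "m \<in> Poly_Mapping.keys f"
    then have "monomial_degree m \<le> (\<Sum>m\<in>Poly_Mapping.keys f. monomial_degree m)"
      by (intro member_le_sum) auto
    then show "Poly_Mapping.lookup m v \<le> (\<Sum>m\<in>Poly_Mapping.keys f. monomial_degree m)"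
      by (rule order.trans[OF lookup_le_monomial_degree])
  qed
qed

lemma ex_common_exponents_bound:
  assumes "finite A"
  shows "\<exists>b. \<forall>i\<in>A. exponents_bounded (f i) b"
proof -
  have "\<forall>i. \<exists>b. exponents_bounded (f i) b" by (simp add: ex_exponents_bounded)
  from choice[OF this] obtain b where b: "\<And>i. exponents_bounded (f i) (b i)" by blast
  have "exponents_bounded (f i) (sum b A)" if "i \<in> A" for i
    by (rule exponents_bounded_mono[OF b]) (use assms that in \<open>auto intro: member_le_sum\<close>)
  then have "\<forall>i\<in>A. exponents_bounded (f i) (sum b A)" by blast
  then show ?thesis ..
qed

text \<open>
  Monomials of bounded exponents can be told apart by one additive weight, by reading the exponents as
  digits in base \<open>B + 1\<close>. The weight serves as a monomial order on the monomials of two given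
  polynomials.
\<close>

lemma ex_injective_weight:
  fixes V :: "'v set"
  assumes "finite V"
  shows "\<exists>w. inj_on (\<lambda>m. \<Sum>v\<in>V. Poly_Mapping.lookup m v * w v) (monomial_box V B)"
  using assms
proof (induction V rule: finite_induct)
  case empty
  then show ?case by (auto simp: monomial_box_def inj_on_def)
next
  case (insert x V)
  then obtain w where w: "inj_on (\<lambda>m. \<Sum>v\<in>V. Poly_Mapping.lookup m v * w v) (monomial_box V B)" by blast
  define w' where "w' v = (if v = x then 1 else w v * (B + 1))" for v
  have sum: "(\<Sum>v\<in>insert x V. Poly_Mapping.lookup m v * w' v)
      = Poly_Mapping.lookup m x + (B + 1) * (\<Sum>v\<in>V. Poly_Mapping.lookup m v * w v)" for m
  proof -
    have "(\<Sum>v\<in>V. Poly_Mapping.lookup m v * w' v) = (\<Sum>v\<in>V. (B + 1) * (Poly_Mapping.lookup m v * w v))"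
      using insert.hyps by (intro sum.cong) (auto simp: w'_def algebra_simps)
    then show ?thesis using insert.hyps by (simp add: w'_def sum_distrib_left)
  qed
  have "inj_on (\<lambda>m. \<Sum>v\<in>insert x V. Poly_Mapping.lookup m v * w' v) (monomial_box (insert x V) B)"
  proof (rule inj_onI)
    fix m n assume m: "m \<in> monomial_box (insert x V) B" and n: "n \<in> monomial_box (insert x V) B"
      and eq: "(\<Sum>v\<in>insert x V. Poly_Mapping.lookup m v * w' v) = (\<Sum>v\<in>insert x V. Poly_Mapping.lookup n v * w' v)"
    let ?s = "\<lambda>m. \<Sum>v\<in>V. Poly_Mapping.lookup m v * w v"
    have lt: "Poly_Mapping.lookup m x < B + 1" "Poly_Mapping.lookup n x < B + 1"
      using m n by (auto simp: monomial_box_def less_Suc_eq_le)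
    have eq': "Poly_Mapping.lookup m x + (B + 1) * ?s m = Poly_Mapping.lookup n x + (B + 1) * ?s n"
      using eq unfolding sum .
    have x: "Poly_Mapping.lookup m x = Poly_Mapping.lookup n x"
      using arg_cong[OF eq', of "\<lambda>k. k mod (B + 1)"] lt by (simp only: mod_mult_self2 mod_less)
    then have "(B + 1) * ?s m = (B + 1) * ?s n" using eq' by linarith
    then have s_eq: "?s m = ?s n" by (simp only: mult_cancel1) simp
    let ?r = "restrict_keys (\<lambda>v. v \<noteq> x)"
    have s: "?s (?r k) = ?s k" for k
      using insert.hyps by (intro sum.cong) (auto simp: lookup_restrict_keys)
    have r: "?r m = ?r n"
    proof (rule inj_onD[OF w])
      show "?s (?r m) = ?s (?r n)" using s_eq by (simp only: s)
      show "?r m \<in> monomial_box V B" "?r n \<in> monomial_box V B"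
        using m n by (auto simp: monomial_box_def keys_restrict_keys lookup_restrict_keys)
    qed
    show "m = n"
    proof (rule poly_mapping_eqI)
      show "Poly_Mapping.lookup m v = Poly_Mapping.lookup n v" for v
        using arg_cong[OF r, of "\<lambda>p. Poly_Mapping.lookup p v"] x
        by (cases "v = x") (simp_all add: lookup_restrict_keys)
    qed
  qed
  then show ?case by blast
qed

lemma lookup_mult_unique_decomposition:
  fixes f g :: "('v, 'k::field) mpoly"
  assumes "a \<in> Poly_Mapping.keys f" "b \<in> Poly_Mapping.keys g"
    and unique: "\<And>p q. p \<in> Poly_Mapping.keys f \<Longrightarrow> q \<in> Poly_Mapping.keys g \<Longrightarrow> p + q = a + b \<Longrightarrow> p = a \<and> q = b"
  shows "Poly_Mapping.lookup (f * g) (a + b) = Poly_Mapping.lookup f a * Poly_Mapping.lookup g b"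
proof -
  let ?t = "\<lambda>(p, q). Poly_Mapping.single (p + q) (Poly_Mapping.lookup f p * Poly_Mapping.lookup g q)"
  let ?X = "Poly_Mapping.keys f \<times> Poly_Mapping.keys g"
  have "f * g = (\<Sum>p\<in>Poly_Mapping.keys f. Poly_Mapping.single p (Poly_Mapping.lookup f p))
       * (\<Sum>q\<in>Poly_Mapping.keys g. Poly_Mapping.single q (Poly_Mapping.lookup g q))"
    by (simp flip: mpoly_eq_sum_single)
  also have "\<dots> = (\<Sum>x\<in>?X. ?t x)"
    by (simp add: sum_product sum.cartesian_product mult_single)
  finally have "Poly_Mapping.lookup (f * g) (a + b) = (\<Sum>x\<in>?X. Poly_Mapping.lookup (?t x) (a + b))"
    by (simp add: lookup_sum)
  also have "\<dots> = (\<Sum>x\<in>{(a, b)}. Poly_Mapping.lookup (?t x) (a + b))"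
  proof (rule sum.mono_neutral_right)
    show "\<forall>x\<in>?X - {(a, b)}. Poly_Mapping.lookup (?t x) (a + b) = 0"
      using unique by (auto simp: lookup_single when_def split: if_splits)
  qed (use assms(1,2) in auto)
  finally show ?thesis by simp
qed

text \<open>
  If neither \<open>f\<close> nor \<open>g\<close> is in the ideal, take in each the monomial of largest weight among those
  supported on \<open>S\<close>. Their product arises in \<open>f * g\<close> in only one way, so it survives there.
\<close>

lemma primeideal_coordinate:
  fixes V S :: "'v set"
  assumes "finite S" "S \<subseteq> V"
  shows "primeideal (stanley_reisner_ideal V (Pow S) :: ('v, 'k::field) mpoly set) (mpoly_ring V)"
    (is "primeideal ?P ?R")
proof (rule primeidealI)
  show "ideal ?P ?R" by (rule stanley_reisner_ideal_is_ideal) auto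
  show "cring ?R" by (rule cring_mpoly_ring)
  have "1 \<in> carrier ?R" "(1 :: ('v, 'k) mpoly) \<notin> ?P"
    by (simp_all add: stanley_reisner_ideal_def)
  then show "carrier ?R \<noteq> ?P" by blast
next
  fix f g :: "('v, 'k) mpoly"
  assume carr: "f \<in> carrier ?R" "g \<in> carrier ?R" and fg: "f \<otimes>\<^bsub>?R\<^esub> g \<in> ?P"
  show "f \<in> ?P \<or> g \<in> ?P"
  proof (rule ccontr)
    assume "\<not> (f \<in> ?P \<or> g \<in> ?P)"
    define part where "part h = {m \<in> Poly_Mapping.keys h. Poly_Mapping.keys m \<subseteq> S}" for h :: "('v, 'k) mpoly"
    have ne: "part f \<noteq> {}" "part g \<noteq> {}"
      using \<open>\<not> (f \<in> ?P \<or> g \<in> ?P)\<close> carr by (auto simp: part_def stanley_reisner_ideal_def)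
    have fin: "finite (part h)" for h by (simp add: part_def)
    obtain B where "\<forall>h\<in>{f, g}. exponents_bounded h B" using ex_common_exponents_bound[of "{f, g}" "\<lambda>h. h"] by auto
    then have box: "part f \<subseteq> monomial_box S B" "part g \<subseteq> monomial_box S B"
      by (auto simp: part_def monomial_box_def exponents_bounded_def)
    obtain w where w: "inj_on (\<lambda>m. \<Sum>v\<in>S. Poly_Mapping.lookup m v * w v) (monomial_box S B)"
      using ex_injective_weight[OF assms(1)] by blast
    define \<phi> where "\<phi> m = (\<Sum>v\<in>S. Poly_Mapping.lookup m v * w v)" for m
    have add: "\<phi> (p + q) = \<phi> p + \<phi> q" for p q
      by (simp add: \<phi>_def lookup_add algebra_simps sum.distrib)
    have inj: "inj_on \<phi> (monomial_box S B)" using w unfolding \<phi>_def .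
    have ex_max: "\<exists>a\<in>X. \<forall>p\<in>X. \<phi> p \<le> \<phi> a" if "finite X" "X \<noteq> {}" for X
    proof -
      have "Max (\<phi> ` X) \<in> \<phi> ` X" using that by (intro Max_in) auto
      then obtain a where a: "a \<in> X" "\<phi> a = Max (\<phi> ` X)" by auto
      have "\<phi> p \<le> \<phi> a" if "p \<in> X" for p using a(2) that \<open>finite X\<close> by simp
      with a(1) show ?thesis by blast
    qed
    obtain a where a: "a \<in> part f" "\<And>p. p \<in> part f \<Longrightarrow> \<phi> p \<le> \<phi> a" using ex_max[OF fin ne(1)] by blast
    obtain b where b: "b \<in> part g" "\<And>p. p \<in> part g \<Longrightarrow> \<phi> p \<le> \<phi> b" using ex_max[OF fin ne(2)] by blast
    have keys: "Poly_Mapping.keys (a + b) \<subseteq> S" using a(1) b(1) by (auto simp: keys_add_monomial part_def)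
    have "Poly_Mapping.lookup (f * g) (a + b) = Poly_Mapping.lookup f a * Poly_Mapping.lookup g b"
    proof (rule lookup_mult_unique_decomposition)
      fix p q assume pq: "p \<in> Poly_Mapping.keys f" "q \<in> Poly_Mapping.keys g" "p + q = a + b"
      have "Poly_Mapping.keys p \<union> Poly_Mapping.keys q \<subseteq> S"
        using keys by (simp only: pq(3)[symmetric] keys_add_monomial)
      then have p: "p \<in> part f" and q: "q \<in> part g" using pq by (auto simp: part_def)
      have "\<phi> p + \<phi> q = \<phi> a + \<phi> b" using add pq(3) by metis
      then have "\<phi> p = \<phi> a" "\<phi> q = \<phi> b" using a(2)[OF p] b(2)[OF q] by linarith+
      then show "p = a \<and> q = b" using inj_onD[OF inj] p q a(1) b(1) box by blast
    qed (use a b in \<open>auto simp: part_def\<close>)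
    also have "\<dots> \<noteq> 0" using a(1) b(1) by (simp add: part_def in_keys_iff)
    finally have "a + b \<in> Poly_Mapping.keys (f * g)" by (simp add: in_keys_iff)
    then show False using fg keys by (auto simp: stanley_reisner_ideal_def)
  qed
qed

section \<open>The Krull dimension of a Stanley--Reisner ring\<close>

lemma primeideal_image_quotient:
  fixes I P :: "('v, 'k::field) mpoly set"
  assumes ideal: "ideal I (mpoly_ring V)" and prime: "primeideal P (mpoly_ring V)" and sub: "I \<subseteq> P"
  shows "primeideal ((\<lambda>f. I +>\<^bsub>mpoly_ring V\<^esub> f) ` P) (mpoly_ring V Quot I)"
    and "f \<in> carrier (mpoly_ring V) \<Longrightarrow>
      I +>\<^bsub>mpoly_ring V\<^esub> f \<in> (\<lambda>f. I +>\<^bsub>mpoly_ring V\<^esub> f) ` P \<longleftrightarrow> f \<in> P"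
proof -
  let ?R = "mpoly_ring V :: ('v, 'k) mpoly ring"
  let ?h = "\<lambda>f. I +>\<^bsub>?R\<^esub> f"
  interpret h: ring_hom_ring ?R "?R Quot I" ?h
    by (rule ideal.rcos_ring_hom_ring[OF ideal])
  have Pi: "ideal P ?R" by (rule primeideal.axioms(1)[OF prime])
  have mem: "?h f \<in> ?h ` P \<longleftrightarrow> f \<in> P" if f: "f \<in> carrier ?R" for f
  proof
    assume "?h f \<in> ?h ` P"
    then obtain p where p: "p \<in> P" "?h f = ?h p" by auto
    have pc: "p \<in> carrier ?R" by (rule ideal.Icarr[OF Pi p(1)])
    then have "f - p \<in> P" using p(2) coset_eq_iff[OF ideal f pc] sub by auto
    from additive_subgroup.a_closed[OF ideal.axioms(1)[OF Pi] this p(1)] show "f \<in> P" by simp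
  qed auto
  show "f \<in> carrier ?R \<Longrightarrow> ?h f \<in> ?h ` P \<longleftrightarrow> f \<in> P" by (rule mem)
  have surj: "\<exists>f\<in>carrier ?R. x = ?h f" if "x \<in> carrier (?R Quot I)" for x
    using that by (auto simp: FactRing_def A_RCOSETS_def')
  show "primeideal (?h ` P) (?R Quot I)"
  proof (rule primeidealI)
    show "ideal (?h ` P) (?R Quot I)" by (rule h.R.ring_ideal_imp_quot_ideal[OF ideal Pi])
    show "cring (?R Quot I)" by (rule ideal.quotient_is_cring[OF ideal cring_mpoly_ring])
    obtain f where "f \<in> carrier ?R" "f \<notin> P"
      using primeideal.I_notcarr[OF prime] ideal.Icarr[OF Pi] by blast
    then have "?h f \<in> carrier (?R Quot I)" "?h f \<notin> ?h ` P" using mem h.hom_closed by simp_all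
    then show "carrier (?R Quot I) \<noteq> ?h ` P" by metis
  next
    fix x y assume x: "x \<in> carrier (?R Quot I)" and y: "y \<in> carrier (?R Quot I)"
      and xy: "x \<otimes>\<^bsub>?R Quot I\<^esub> y \<in> ?h ` P"
    from surj[OF x] obtain f where f: "f \<in> carrier ?R" "x = ?h f" ..
    from surj[OF y] obtain g where g: "g \<in> carrier ?R" "y = ?h g" ..
    have "?h (f \<otimes>\<^bsub>?R\<^esub> g) \<in> ?h ` P" using xy f g h.hom_mult by simp
    then have "f \<otimes>\<^bsub>?R\<^esub> g \<in> P" using mem[OF h.R.m_closed[OF f(1) g(1)]] by simp
    then have "f \<in> P \<or> g \<in> P" by (rule primeideal.I_prime[OF prime f(1) g(1)])
    then show "x \<in> ?h ` P \<or> y \<in> ?h ` P" using f(2) g(2) by auto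
  qed
qed

context simplicial_complex
begin

text \<open>
  A chain of length \<open>n\<close> provides elements \<open>a 0, \<dots>, a (n - 1)\<close> whose \<open>(N + 1) ^ n\<close> power products with
  exponents up to \<open>N\<close> are linearly independent modulo the ideal. Their exponents in the variables grow
  linearly in \<open>N\<close>, so that modulo the ideal they involve only \<open>O(N ^ max_face_card)\<close> monomials. For
  large \<open>N\<close> this forces \<open>n \<le> max_face_card\<close>.
\<close>

lemma prime_chain_length_le:
  fixes P :: "nat \<Rightarrow> ('v, 'k::field) mpoly set"
  assumes prime: "\<And>i. i \<le> n \<Longrightarrow> primeideal (P i) (mpoly_ring V)"
    and chain: "\<And>i. i < n \<Longrightarrow> P i \<subset> P (Suc i)"
    and sub: "stanley_reisner_ideal V \<Delta> \<subseteq> P 0"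
  shows "n \<le> max_face_card"
proof (rule ccontr)
  let ?D = max_face_card
  assume "\<not> n \<le> ?D"
  have "\<forall>i. \<exists>x. i < n \<longrightarrow> x \<in> P (Suc i) - P i" using chain by blast
  then obtain a where a: "\<And>i. i < n \<Longrightarrow> a i \<in> P (Suc i)" "\<And>i. i < n \<Longrightarrow> a i \<notin> P i" by (metis Diff_iff)
  have ac: "a j \<in> carrier (mpoly_ring V)" if "j < n" for j
    using a(1)[OF that] prime[of "Suc j"] that
    by (auto dest: primeideal.axioms(1) intro: ideal.Icarr)
  obtain L where L: "\<And>i. i < n \<Longrightarrow> exponents_bounded (a i) L"
    using ex_common_exponents_bound[of "{..<n}" a] by auto
  \<comment> \<open>Chosen such that \<open>card \<Delta> * ((n * L + 1) * (N + 1)) ^ max_face_card = N * (N + 1) ^ max_face_card\<close>.\<close>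
  define N where "N = card \<Delta> * (n * L + 1) ^ ?D"
  define B where "B = n * (N * L)"
  define E where "E = {..<n} \<rightarrow>\<^sub>E {..N}"
  define M where "M = (\<Union>S\<in>\<Delta>. monomial_box S B)"
  have finE: "finite E" unfolding E_def by (intro finite_PiE) auto
  have finM: "finite M" unfolding M_def using finite_faces finite_face finite_monomial_box by blast
  have "card M \<le> (\<Sum>S\<in>\<Delta>. card (monomial_box S B))"
    unfolding M_def by (rule card_UN_le[OF finite_faces])
  also have "\<dots> \<le> (\<Sum>S\<in>\<Delta>. (B + 1) ^ ?D)"
    by (intro sum_mono) (auto simp: card_monomial_box finite_face card_face_le intro!: power_increasing)
  also have "\<dots> = card \<Delta> * (B + 1) ^ ?D" by simp
  also have "\<dots> \<le> card \<Delta> * ((n * L + 1) * (N + 1)) ^ ?D"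
    by (intro mult_left_mono power_mono) (auto simp: B_def algebra_simps)
  also have "\<dots> = N * (N + 1) ^ ?D" by (simp only: power_mult_distrib mult.assoc[symmetric] N_def[symmetric])
  also have "\<dots> < (N + 1) ^ Suc ?D" by simp
  also have "\<dots> \<le> (N + 1) ^ n" by (rule power_increasing) (use \<open>\<not> n \<le> ?D\<close> in auto)
  also have "\<dots> = card E" by (simp add: E_def card_PiE)
  finally have "card M < card E" .
  define mon where "mon e = (\<Prod>j\<in>{0..<n}. a j ^ e j)" for e :: "nat \<Rightarrow> nat"
  obtain x where x: "\<exists>e\<in>E. x e \<noteq> 0" "\<And>m. m \<in> M \<Longrightarrow> (\<Sum>e\<in>E. x e * Poly_Mapping.lookup (mon e) m) = 0"
    using homogeneous_linear_system_nontrivial_solution[OF finM finE \<open>card M < card E\<close>,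
        of "\<lambda>e m. Poly_Mapping.lookup (mon e) m"] by blast
  define f where "f = (\<Sum>e\<in>E. mconst (x e) * mon e)"
  have monc: "mon e \<in> carrier (mpoly_ring V)" for e
    unfolding mon_def using ac by (intro mpoly_ring_prod_closed mpoly_ring_power_closed) auto
  have fc: "f \<in> carrier (mpoly_ring V)"
    unfolding f_def by (intro mpoly_ring_sum_closed mpoly_ring_closed mconst_in_mpoly_ring monc)
  have lookup_f: "Poly_Mapping.lookup f m = (\<Sum>e\<in>E. x e * Poly_Mapping.lookup (mon e) m)" for m
    by (simp add: f_def lookup_sum lookup_mconst_mult)
  have bound: "exponents_bounded (mon e) B" if "e \<in> E" for e
  proof -
    have "exponents_bounded (a j ^ e j) (N * L)" if "j \<in> {0..<n}" for j
    proof (rule exponents_bounded_mono[OF exponents_bounded_power[OF L]])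
      show "e j * L \<le> N * L" using \<open>e \<in> E\<close> that by (auto simp: E_def intro!: mult_right_mono)
    qed (use that in auto)
    then have "exponents_bounded (mon e) (card {0..<n} * (N * L))"
      unfolding mon_def by (rule exponents_bounded_prod) simp_all
    then show ?thesis by (simp add: B_def)
  qed
  have "Poly_Mapping.keys m \<notin> \<Delta>" if m: "m \<in> Poly_Mapping.keys f" for m
  proof
    assume face: "Poly_Mapping.keys m \<in> \<Delta>"
    have "\<exists>e\<in>E. Poly_Mapping.lookup (mon e) m \<noteq> 0"
    proof (rule ccontr)
      assume "\<not> ?thesis"
      then have "Poly_Mapping.lookup f m = 0" by (simp add: lookup_f)
      then show False using m by (simp add: in_keys_iff)
    qed
    then have "m \<in> monomial_box (Poly_Mapping.keys m) B"
      using bound by (auto simp: monomial_box_def exponents_bounded_def in_keys_iff)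
    then have "m \<in> M" using face by (auto simp: M_def)
    then have "Poly_Mapping.lookup f m = 0" using x(2) by (simp add: lookup_f)
    then show False using m by (simp add: in_keys_iff)
  qed
  then have "f \<in> P 0" using fc sub by (auto simp: stanley_reisner_ideal_def)
  have "\<forall>e\<in>E. x e = 0"
  proof (rule prime_chain_monomials_independent[where P = P and a = a and n = n and i = 0])
    show "e = e'" if "e \<in> E" "e' \<in> E" "\<And>j. 0 \<le> j \<Longrightarrow> j < n \<Longrightarrow> e j = e' j" for e e'
      using that unfolding E_def by (intro PiE_ext) auto
    show "(\<Sum>e\<in>E. mconst (x e) * (\<Prod>j\<in>{0..<n}. a j ^ e j)) \<in> P 0"
      using \<open>f \<in> P 0\<close> unfolding f_def mon_def .
  qed (use prime chain a finE in auto)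
  then show False using x(1) by blast
qed

text \<open>
  Start from the coordinate prime of a largest face and remove its vertices one at a time.
\<close>

lemma prime_chain_of_facet:
  obtains P :: "nat \<Rightarrow> ('v, 'k::field) mpoly set"
  where "\<And>i. i \<le> max_face_card \<Longrightarrow> primeideal (P i) (mpoly_ring V)"
    "\<And>i. i < max_face_card \<Longrightarrow> P i \<subset> P (Suc i)"
    "\<And>i. stanley_reisner_ideal V \<Delta> \<subseteq> P i"
proof -
  obtain F where F: "F \<in> \<Delta>" "card F = max_face_card" by (rule obtain_facet)
  obtain g where g: "bij_betw g {0..<max_face_card} F"
    using ex_bij_betw_nat_finite[OF finite_face[OF F(1)]] F(2) by auto
  define S where "S i = F - g ` {0..<i}" for i
  define P where "P i = (stanley_reisner_ideal V (Pow (S i)) :: ('v, 'k) mpoly set)" for i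
  have S: "finite (S i)" "S i \<subseteq> V" for i
    using finite_face[OF F(1)] face_subset[OF F(1)] by (auto simp: S_def)
  show ?thesis
  proof (rule that[of P])
    show "primeideal (P i) (mpoly_ring V)" for i
      unfolding P_def by (rule primeideal_coordinate[OF S])
    show "stanley_reisner_ideal V \<Delta> \<subseteq> P i" for i
      using down_closed[OF F(1)] by (auto simp: P_def S_def stanley_reisner_ideal_def)
    fix i assume i: "i < max_face_card"
    have gi: "g i \<in> F" using g i by (auto simp: bij_betw_def)
    have "g i \<notin> g ` {0..<i}"
      using i inj_onD[OF bij_betw_imp_inj_on[OF g], of i] by fastforce
    then have gS: "g i \<in> S i" "g i \<notin> S (Suc i)" using gi by (auto simp: S_def)
    have "S (Suc i) \<subseteq> S i" by (auto simp: S_def)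
    then have "P i \<subseteq> P (Suc i)" by (auto simp: P_def stanley_reisner_ideal_def)
    moreover have "mvar (g i) \<in> P (Suc i)" "mvar (g i) \<notin> P i"
      using gS face_subset[OF F(1)] gi by (auto simp: P_def stanley_reisner_ideal_def mvar_def)
    ultimately show "P i \<subset> P (Suc i)" by blast
  qed
qed

lemma krull_dim_quotient:
  fixes I :: "('v, 'k::field) mpoly set"
  assumes I: "I = stanley_reisner_ideal V \<Delta>"
  shows "krull_dim (mpoly_ring V Quot I) = enat max_face_card"
proof -
  let ?R = "mpoly_ring V :: ('v, 'k) mpoly ring"
  let ?h = "\<lambda>f. I +>\<^bsub>?R\<^esub> f"
  have ideal: "ideal I ?R" unfolding I by (rule sr_ideal)
  interpret h: ring_hom_ring ?R "?R Quot I" ?h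
    by (rule ideal.rcos_ring_hom_ring[OF ideal])
  have le: "n \<le> max_face_card"
    if Q: "\<And>i. i \<le> n \<Longrightarrow> primeideal (Q i) (?R Quot I)" "\<And>i. i < n \<Longrightarrow> Q i \<subset> Q (Suc i)" for n Q
  proof -
    define P where "P i = {f \<in> carrier ?R. ?h f \<in> Q i}" for i
    have Qc: "Q i \<subseteq> carrier (?R Quot I)" if "i \<le> n" for i
      by (rule subsetI) (rule ideal.Icarr[OF primeideal.axioms(1)[OF Q(1)[OF that]]])
    show ?thesis
    proof (rule prime_chain_length_le[of n P])
      show "primeideal (P i) ?R" if "i \<le> n" for i
        unfolding P_def by (rule h.primeideal_vimage[OF cring_mpoly_ring Q(1)[OF that]])
      show "P i \<subset> P (Suc i)" if i: "i < n" for i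
      proof -
        obtain x where x: "x \<in> Q (Suc i)" "x \<notin> Q i" using Q(2)[OF i] by blast
        then have "x \<in> carrier (?R Quot I)" using Qc[of "Suc i"] i by auto
        then obtain f where "f \<in> carrier ?R" "x = ?h f" by (auto simp: FactRing_def A_RCOSETS_def')
        then have "f \<in> P (Suc i)" "f \<notin> P i" using x by (auto simp: P_def)
        moreover have "P i \<subseteq> P (Suc i)" using Q(2)[OF i] by (auto simp: P_def)
        ultimately show ?thesis by blast
      qed
      show "stanley_reisner_ideal V \<Delta> \<subseteq> P 0"
      proof
        fix f :: "('v, 'k) mpoly" assume "f \<in> stanley_reisner_ideal V \<Delta>"
        then have f: "f \<in> I" by (simp add: I)
        then have fc: "f \<in> carrier ?R" by (rule ideal.Icarr[OF ideal])
        then have "?h f = \<zero>\<^bsub>?R Quot I\<^esub>"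
          using f coset_eq_iff[OF ideal fc, of 0] h.hom_zero by simp
        moreover have "\<zero>\<^bsub>?R Quot I\<^esub> \<in> Q 0"
          by (rule additive_subgroup.zero_closed[OF ideal.axioms(1)[OF primeideal.axioms(1)[OF Q(1)]]]) simp
        ultimately show "f \<in> P 0" using fc by (simp add: P_def)
      qed
    qed
  qed
  obtain P :: "nat \<Rightarrow> ('v, 'k) mpoly set" where
    P: "\<And>i. i \<le> max_face_card \<Longrightarrow> primeideal (P i) ?R"
      "\<And>i. i < max_face_card \<Longrightarrow> P i \<subset> P (Suc i)" "\<And>i. I \<subseteq> P i"
    unfolding I by (rule prime_chain_of_facet) blast
  have ge: "\<exists>Q. (\<forall>i\<le>max_face_card. primeideal (Q i) (?R Quot I)) \<and> (\<forall>i<max_face_card. Q i \<subset> Q (Suc i))"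
  proof (intro exI conjI allI impI)
    show "primeideal (?h ` P i) (?R Quot I)" if "i \<le> max_face_card" for i
      by (rule primeideal_image_quotient(1)[OF ideal P(1)[OF that] P(3)])
    show "?h ` P i \<subset> ?h ` P (Suc i)" if i: "i < max_face_card" for i
    proof -
      obtain f where f: "f \<in> P (Suc i)" "f \<notin> P i" using P(2)[OF i] by blast
      have fc: "f \<in> carrier ?R"
        using i by (intro ideal.Icarr[OF primeideal.axioms(1)[OF P(1)] f(1)]) simp
      then have "?h f \<notin> ?h ` P i"
        using primeideal_image_quotient(2)[OF ideal P(1) P(3) fc, of i] f(2) i by simp
      then show ?thesis using f(1) P(2)[OF i] by blast
    qed
  qed
  show ?thesis unfolding krull_dim_def
  proof (rule antisym)
    show "Sup {enat n |n. \<exists>P. (\<forall>i\<le>n. primeideal (P i) (?R Quot I)) \<and> (\<forall>i<n. P i \<subset> P (Suc i))}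
        \<le> enat max_face_card"
    proof (rule Sup_least)
      fix x assume "x \<in> {enat n |n. \<exists>P. (\<forall>i\<le>n. primeideal (P i) (?R Quot I)) \<and> (\<forall>i<n. P i \<subset> P (Suc i))}"
      then obtain n P where "x = enat n" "\<forall>i\<le>n. primeideal (P i) (?R Quot I)" "\<forall>i<n. P i \<subset> P (Suc i)"
        by blast
      then show "x \<le> enat max_face_card" using le[of n P] by simp
    qed
    show "enat max_face_card
        \<le> Sup {enat n |n. \<exists>P. (\<forall>i\<le>n. primeideal (P i) (?R Quot I)) \<and> (\<forall>i<n. P i \<subset> P (Suc i))}"
      by (rule Sup_upper) (use ge in auto)
  qed
qed

text \<open>
  Together, the Hilbert series and the Krull dimension determine the \<open>h\<close>-polynomial of the quotient.
\<close>

theorem h_poly_quot_stanley_reisner: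
  "h_poly_quot V (stanley_reisner_ideal V \<Delta> :: ('v, 'k::field) mpoly set) = h_vector_poly"
  unfolding h_poly_quot_def h_poly_def krull_dim_quotient[OF refl] the_enat.simps
    hilbert_series_mult[OF refl]
  by (rule the_equality) (auto simp: fps_of_poly_eq_iff)

end

section \<open>Squarefree monomial ideals and face polynomials\<close>

definition squarefree_monomial :: "'v set \<Rightarrow> 'v \<Rightarrow>\<^sub>0 nat" where
  "squarefree_monomial C = (\<Sum>v\<in>C. Poly_Mapping.single v 1)"

lemma lookup_squarefree_monomial:
  "finite C \<Longrightarrow> Poly_Mapping.lookup (squarefree_monomial C) v = (if v \<in> C then 1 else 0)"
  by (simp add: squarefree_monomial_def lookup_sum lookup_single when_def)

lemma prod_mvar:
  "finite C \<Longrightarrow> (\<Prod>v\<in>C. mvar v) = (Poly_Mapping.single (squarefree_monomial C) 1 :: ('v, 'k::field) mpoly)"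
  unfolding squarefree_monomial_def
  by (induction C rule: finite_induct) (simp_all add: mvar_def mult_single)

text \<open>
  The nonfaces of \<open>\<Delta>\<close> are the sets that contain a generator, and a monomial is divisible by a
  squarefree monomial iff its support contains the support of that one.
\<close>

lemma genideal_squarefree_monomials:
  fixes \<G> :: "'v set set"
  assumes fin: "finite V" and \<G>: "\<And>C. C \<in> \<G> \<Longrightarrow> C \<subseteq> V"
    and \<Delta>: "\<Delta> = {S. S \<subseteq> V \<and> \<not> (\<exists>C\<in>\<G>. C \<subseteq> S)}"
  shows "Idl\<^bsub>mpoly_ring V\<^esub> {(\<Prod>v\<in>C. mvar v) | C. C \<in> \<G>}
       = (stanley_reisner_ideal V \<Delta> :: ('v, 'k::field) mpoly set)"
proof -
  let ?R = "mpoly_ring V :: ('v, 'k) mpoly ring"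
  let ?X = "{(\<Prod>v\<in>C. mvar v) | C. C \<in> \<G>} :: ('v, 'k) mpoly set"
  interpret R: cring ?R by (rule cring_mpoly_ring)
  have finC: "finite C" if "C \<in> \<G>" for C using \<G>[OF that] fin finite_subset by blast
  have keysC: "Poly_Mapping.keys (squarefree_monomial C) = C" if "C \<in> \<G>" for C
    using finC[OF that] by (auto simp: in_keys_iff lookup_squarefree_monomial split: if_splits)
  have ideal: "ideal (stanley_reisner_ideal V \<Delta> :: ('v, 'k) mpoly set) ?R"
    by (rule stanley_reisner_ideal_is_ideal) (unfold \<Delta>, blast)
  have X: "?X \<subseteq> stanley_reisner_ideal V \<Delta>"
    using \<G> by (auto simp: prod_mvar finC stanley_reisner_ideal_def keysC \<Delta>)
  then have Xc: "?X \<subseteq> carrier ?R" by (auto simp: stanley_reisner_ideal_def)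
  have idl: "ideal (Idl\<^bsub>?R\<^esub> ?X) ?R" by (rule R.genideal_ideal[OF Xc])
  show ?thesis
  proof
    show "Idl\<^bsub>?R\<^esub> ?X \<subseteq> stanley_reisner_ideal V \<Delta>" by (rule R.genideal_minimal[OF ideal X])
    show "stanley_reisner_ideal V \<Delta> \<subseteq> Idl\<^bsub>?R\<^esub> ?X"
    proof
      fix f :: "('v, 'k) mpoly" assume f: "f \<in> stanley_reisner_ideal V \<Delta>"
      have "Poly_Mapping.single m c \<in> Idl\<^bsub>?R\<^esub> ?X" if m: "m \<in> Poly_Mapping.keys f" for m and c :: 'k
      proof -
        have mV: "Poly_Mapping.keys m \<subseteq> V" and "Poly_Mapping.keys m \<notin> \<Delta>"
          using f m by (auto simp: stanley_reisner_ideal_def in_mpoly_ring_iff)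
        then obtain C where C: "C \<in> \<G>" "C \<subseteq> Poly_Mapping.keys m" by (auto simp: \<Delta>)
        let ?s = "squarefree_monomial C"
        have "1 \<le> Poly_Mapping.lookup m v" if "v \<in> C" for v
          using C(2) that by (auto simp: in_keys_iff Suc_le_eq)
        then have "m = (m - ?s) + ?s"
          by (intro poly_mapping_eqI) (simp add: lookup_add lookup_minus lookup_squarefree_monomial[OF finC[OF C(1)]])
        then have "Poly_Mapping.single m c = Poly_Mapping.single (m - ?s) c * (\<Prod>v\<in>C. mvar v)"
          by (metis prod_mvar[OF finC[OF C(1)]] mult_single mult.right_neutral)
        also have "\<dots> \<in> Idl\<^bsub>?R\<^esub> ?X"
        proof (rule ideal_mult_closed[OF idl])
          show "(\<Prod>v\<in>C. mvar v) \<in> Idl\<^bsub>?R\<^esub> ?X" using R.genideal_self[OF Xc] C(1) by blast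
          have "Poly_Mapping.keys (m - ?s) \<subseteq> Poly_Mapping.keys m" by (auto simp: in_keys_iff lookup_minus)
          then show "Poly_Mapping.single (m - ?s) c \<in> carrier ?R" using mV by (intro single_in_mpoly_ring) blast
        qed
        finally show ?thesis .
      qed
      then have "(\<Sum>m\<in>Poly_Mapping.keys f. Poly_Mapping.single m (Poly_Mapping.lookup f m)) \<in> Idl\<^bsub>?R\<^esub> ?X"
        by (rule ideal_sum_closed[OF idl])
      then show "f \<in> Idl\<^bsub>?R\<^esub> ?X" by (simp flip: mpoly_eq_sum_single)
    qed
  qed
qed

context simplicial_complex
begin

definition f_poly :: "int poly" where
  "f_poly = (\<Sum>i\<le>max_face_card. monom (int (card {S \<in> \<Delta>. card S = i})) i)"

lemma coeff_f_poly: "coeff f_poly i = int (card {S \<in> \<Delta>. card S = i})"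
proof (cases "i \<le> max_face_card")
  case False
  then have "{S \<in> \<Delta>. card S = i} = {}" using card_face_le by auto
  then have "card {S \<in> \<Delta>. card S = i} = 0" by (simp only: card.empty)
  with False show ?thesis unfolding f_poly_def by (simp add: coeff_sum)
qed (simp add: f_poly_def coeff_sum)

lemma degree_f_poly_le: "degree f_poly \<le> max_face_card"
  unfolding f_poly_def by (intro degree_sum_le) (auto intro: order.trans[OF degree_monom_le])

lemma f_poly_nonzero: "f_poly \<noteq> 0"
proof
  assume "f_poly = 0"
  then have "card {S \<in> \<Delta>. card S = 0} = 0" using coeff_f_poly[of 0] by simp
  then show False using empty_face finite_faces by (auto simp: card_eq_0_iff)
qed

lemma sum_faces_eq_homogenization:
  assumes "max_face_card \<le> N"
  shows "(\<Sum>S\<in>\<Delta>. a ^ card S * b ^ (N - card S)) = homogenization N f_poly a b"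
proof -
  have "(\<Sum>S\<in>\<Delta>. a ^ card S * b ^ (N - card S))
      = (\<Sum>i\<le>N. \<Sum>S\<in>{S \<in> \<Delta>. card S = i}. a ^ card S * b ^ (N - card S))"
    using finite_faces card_face_le assms order.trans by (intro sum.group[symmetric]) auto
  also have "\<dots> = (\<Sum>i\<le>N. \<Sum>S\<in>{S \<in> \<Delta>. card S = i}. a ^ i * b ^ (N - i))"
    by (intro sum.cong) auto
  also have "\<dots> = homogenization N f_poly a b"
    by (simp add: homogenization_def coeff_f_poly of_nat_poly)
  finally show ?thesis .
qed

lemma degree_h_vector_poly: "degree h_vector_poly = max_face_card - order (-1) f_poly"
  using degree_homogenization[OF f_poly_nonzero degree_f_poly_le, of 1 0]
    sum_faces_eq_homogenization[OF order_refl, of "[:0, 1:]" "[:1, - 1:]"]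
  by (simp add: h_vector_poly_def)

lemma order_f_poly_le: "order (-1) f_poly \<le> max_face_card"
  using order_degree[OF f_poly_nonzero] degree_f_poly_le order.trans by blast

end

section \<open>Edge ideals and cover ideals\<close>

context pair_graph
begin

lemma independence_complex: "simplicial_complex (pverts G) {S. independent_set G S}"
  using pair_finite_verts by unfold_locales (auto simp: independent_set_def)

lemma edge_ideal_eq_stanley_reisner:
  "edge_ideal G = (stanley_reisner_ideal (pverts G) {S. independent_set G S} :: ('a, 'k::field) mpoly set)"
proof -
  define \<G> where "\<G> = (\<lambda>(u, v). {u, v}) ` parcs G"
  have "{mvar u * mvar v | u v. (u, v) \<in> parcs G} = (\<lambda>(u, v). mvar u * mvar v :: ('a, 'k) mpoly) ` parcs G"
    by auto
  also have "\<dots> = (\<lambda>C. \<Prod>w\<in>C. mvar w) ` \<G>"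
    unfolding \<G>_def image_image by (intro image_cong refl) (auto dest: no_loops')
  also have "\<dots> = {(\<Prod>v\<in>C. mvar v) | C. C \<in> \<G>}" by auto
  finally have gen: "{mvar u * mvar v | u v. (u, v) \<in> parcs G}
      = ({(\<Prod>v\<in>C. mvar v) | C. C \<in> \<G>} :: ('a, 'k) mpoly set)" .
  show ?thesis unfolding edge_ideal_def gen
  proof (rule genideal_squarefree_monomials[OF pair_finite_verts])
    show "C \<subseteq> pverts G" if "C \<in> \<G>" for C
      using that in_arcsD1 in_arcsD2 by (auto simp: \<G>_def)
    show "{S. independent_set G S} = {S. S \<subseteq> pverts G \<and> \<not> (\<exists>C\<in>\<G>. C \<subseteq> S)}"
      by (auto simp: independent_set_def \<G>_def)
  qed
qed

lemma ex_minimal_vertex_cover: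
  assumes "vertex_cover G S"
  shows "\<exists>C. C \<subseteq> S \<and> minimal_vertex_cover G C"
proof -
  have "S \<subseteq> pverts G" using assms by (simp add: vertex_cover_def)
  then have "finite S" using pair_finite_verts by (rule finite_subset)
  then show ?thesis using assms
  proof (induction S rule: finite_psubset_induct)
    case (psubset S)
    show ?case
    proof (cases "minimal_vertex_cover G S")
      case False
      then obtain D where "D \<subset> S" "vertex_cover G D"
        using psubset.prems by (auto simp: minimal_vertex_cover_def)
      moreover from psubset.IH[OF this] obtain C where "C \<subseteq> D" "minimal_vertex_cover G C" by blast
      ultimately have "C \<subseteq> S \<and> minimal_vertex_cover G C" by simp
      then show ?thesis ..
    qed blast
  qed
qed

lemma vertex_cover_superset:
  "vertex_cover G C \<Longrightarrow> C \<subseteq> S \<Longrightarrow> S \<subseteq> pverts G \<Longrightarrow> vertex_cover G S"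
  by (auto simp: vertex_cover_def)

lemma vertex_cover_iff_independent_compl:
  assumes "S \<subseteq> pverts G"
  shows "vertex_cover G S \<longleftrightarrow> independent_set G (pverts G - S)"
proof -
  have "vertex_cover G S \<longleftrightarrow> (\<forall>u v. (u, v) \<in> parcs G \<longrightarrow> u \<in> S \<or> v \<in> S)"
    using assms by (auto simp: vertex_cover_def)
  also have "\<dots> \<longleftrightarrow> (\<forall>u v. (u, v) \<in> parcs G \<longrightarrow> u \<notin> pverts G - S \<or> v \<notin> pverts G - S)"
    by (meson DiffD2 DiffI in_arcsD1 in_arcsD2)
  also have "\<dots> \<longleftrightarrow> independent_set G (pverts G - S)"
    by (auto simp: independent_set_def)
  finally show ?thesis .
qed

lemma cover_ideal_eq_stanley_reisner:
  "cover_ideal G = (stanley_reisner_ideal (pverts G) {S. S \<subseteq> pverts G \<and> \<not> vertex_cover G S} :: ('a, 'k::field) mpoly set)"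
proof -
  have "cover_ideal G = (Idl\<^bsub>mpoly_ring (pverts G)\<^esub> {(\<Prod>v\<in>C. mvar v) | C. C \<in> {C. minimal_vertex_cover G C}} :: ('a, 'k) mpoly set)"
    by (simp add: cover_ideal_def)
  also have "\<dots> = stanley_reisner_ideal (pverts G) {S. S \<subseteq> pverts G \<and> \<not> vertex_cover G S}"
  proof (rule genideal_squarefree_monomials[OF pair_finite_verts])
    show "C \<subseteq> pverts G" if "C \<in> {C. minimal_vertex_cover G C}" for C
      using that by (simp add: minimal_vertex_cover_def vertex_cover_def)
    have "vertex_cover G S \<longleftrightarrow> (\<exists>C\<in>{C. minimal_vertex_cover G C}. C \<subseteq> S)" if "S \<subseteq> pverts G" for S
      using that ex_minimal_vertex_cover[of S] vertex_cover_superset[of _ S]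
      by (auto simp: minimal_vertex_cover_def)
    then show "{S. S \<subseteq> pverts G \<and> \<not> vertex_cover G S}
        = {S. S \<subseteq> pverts G \<and> \<not> (\<exists>C\<in>{C. minimal_vertex_cover G C}. C \<subseteq> S)}" by blast
  qed
  finally show ?thesis .
qed

interpretation Ind: simplicial_complex "pverts G" "{S. independent_set G S}"
  by (rule independence_complex)

lemma independence_number_eq: "independence_number G = Ind.max_face_card"
  by (simp add: independence_number_def Ind.max_face_card_def)

lemma independence_poly_eq: "independence_poly G = Ind.f_poly"
  by (simp add: independence_poly_def Ind.f_poly_def independence_number_eq)

lemma mult_minus_one_eq: "mult_minus_one G = order (-1) (independence_poly G)"
  using order_map_poly_of_int[of "independence_poly G" "-1", where 'a = rat] Ind.f_poly_nonzero
  by (simp add: mult_minus_one_def independence_poly_eq)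

lemma mult_minus_one_le: "mult_minus_one G \<le> independence_number G"
  by (simp add: mult_minus_one_eq independence_poly_eq independence_number_eq Ind.order_f_poly_le)

lemma degree_h_poly_edge_ideal:
  "degree (h_poly_quot (pverts G) (edge_ideal G :: ('a, 'k::field) mpoly set))
   = independence_number G - mult_minus_one G"
  unfolding edge_ideal_eq_stanley_reisner Ind.h_poly_quot_stanley_reisner Ind.degree_h_vector_poly
  by (simp add: mult_minus_one_eq independence_poly_eq independence_number_eq)

lemma cover_complex:
  assumes "parcs G \<noteq> {}"
  shows "simplicial_complex (pverts G) {S. S \<subseteq> pverts G \<and> \<not> vertex_cover G S}"
proof
  show "{} \<in> {S. S \<subseteq> pverts G \<and> \<not> vertex_cover G S}"
    using assms by (auto simp: vertex_cover_def)
qed (use pair_finite_verts vertex_cover_superset in auto)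

text \<open>
  A set fails to be a cover because it misses both ends of some edge, and the complement of an edge
  is such a set.
\<close>

lemma max_face_card_cover_complex:
  assumes "parcs G \<noteq> {}"
  shows "simplicial_complex.max_face_card {S. S \<subseteq> pverts G \<and> \<not> vertex_cover G S} = card (pverts G) - 2"
    and "2 \<le> card (pverts G)"
proof -
  interpret Cov: simplicial_complex "pverts G" "{S. S \<subseteq> pverts G \<and> \<not> vertex_cover G S}"
    by (rule cover_complex[OF assms])
  have two: "card (pverts G - {u, v}) = card (pverts G) - 2 \<and> 2 \<le> card (pverts G)"
    if "(u, v) \<in> parcs G" for u v
  proof -
    have uv: "{u, v} \<subseteq> pverts G" "card {u, v} = 2"
      using in_arcsD1[OF that] in_arcsD2[OF that] no_loops'[OF that] by auto
    then show ?thesis using card_Diff_subset[of "{u, v}" "pverts G"] card_mono[OF pair_finite_verts uv(1)] by simp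
  qed
  obtain u v where uv: "(u, v) \<in> parcs G" using assms by auto
  show "2 \<le> card (pverts G)" using two[OF uv] by simp
  have "pverts G - {u, v} \<in> {S. S \<subseteq> pverts G \<and> \<not> vertex_cover G S}"
    using uv by (auto simp: vertex_cover_def)
  from Cov.card_face_le[OF this] have ge: "card (pverts G) - 2 \<le> Cov.max_face_card"
    using two[OF uv] by simp
  obtain F where F: "F \<in> {S. S \<subseteq> pverts G \<and> \<not> vertex_cover G S}" "card F = Cov.max_face_card"
    by (rule Cov.obtain_facet)
  then obtain x y where xy: "(x, y) \<in> parcs G" "x \<notin> F" "y \<notin> F" by (auto simp: vertex_cover_def)
  have "card F \<le> card (pverts G - {x, y})"
    using F(1) xy pair_finite_verts by (intro card_mono) auto
  then show "Cov.max_face_card = card (pverts G) - 2" using two[OF xy(1)] ge F(2) by simp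
qed

text \<open>
  Split the binomial expansion of \<open>(t + (1 - t)) ^ n = 1\<close> over all vertex sets into the noncovers, which
  give \<open>(1 - t)\<^sup>2 * h\<close>, and the covers, whose complements are the independent sets.
\<close>

lemma degree_h_poly_cover_ideal:
  assumes edge: "parcs G \<noteq> {}"
  shows "degree (h_poly_quot (pverts G) (cover_ideal G :: ('a, 'k::field) mpoly set)) + 2
    = card (pverts G) - mult_minus_one G"
proof -
  let ?V = "pverts G" and ?n = "card (pverts G)"
  let ?I = "{S. independent_set G S}" and ?C = "{S. S \<subseteq> pverts G \<and> \<not> vertex_cover G S}"
  let ?t = "[:0, 1:] :: int poly" and ?s = "[:1, - 1:] :: int poly"
  interpret Cov: simplicial_complex ?V ?C by (rule cover_complex[OF edge])
  note D = max_face_card_cover_complex[OF edge]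
  let ?h = Cov.h_vector_poly
  define H where "H = homogenization ?n (independence_poly G) ?s ?t"
  have alpha: "independence_number G < ?n"
  proof -
    obtain F where F: "F \<in> ?I" "card F = independence_number G"
      unfolding independence_number_eq by (rule Ind.obtain_facet)
    obtain u v where "(u, v) \<in> parcs G" using edge by auto
    then have "\<not> independent_set G ?V"
      using in_arcsD1[of u v] in_arcsD2[of u v] by (auto simp: independent_set_def)
    then have "F \<noteq> ?V" using F(1) by auto
    moreover have "F \<subseteq> ?V" using F(1) by (simp add: independent_set_def)
    ultimately have "F \<subset> ?V" by simp
    then show ?thesis using psubset_card_mono[OF pair_finite_verts] F(2) by metis
  qed
  have "?s ^ 2 * ?h = (\<Sum>S\<in>?C. ?t ^ card S * ?s ^ (?n - card S))"
    unfolding Cov.h_vector_poly_def sum_distrib_left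
  proof (rule sum.cong)
    fix S assume "S \<in> ?C"
    then have "card S \<le> ?n - 2" using Cov.card_face_le D(1) by metis
    then have "?n - card S = 2 + (Cov.max_face_card - card S)" using D by simp
    then show "?s ^ 2 * (?t ^ card S * ?s ^ (Cov.max_face_card - card S)) = ?t ^ card S * ?s ^ (?n - card S)"
      by (simp only: power_add mult_ac)
  qed simp
  moreover have "(\<Sum>S\<in>Pow ?V. ?t ^ card S * ?s ^ (?n - card S)) = 1"
  proof -
    have "(\<Sum>S\<in>Pow ?V. ?t ^ card S * ?s ^ (?n - card S))
        = (\<Sum>S\<in>Pow ?V. (\<Prod>x\<in>S. ?t) * (\<Prod>x\<in>?V - S. ?s))"
    proof (rule sum.cong)
      fix S assume "S \<in> Pow ?V"
      then have "card (?V - S) = ?n - card S"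
        using finite_subset[OF _ pair_finite_verts] by (intro card_Diff_subset) auto
      then show "?t ^ card S * ?s ^ (?n - card S) = (\<Prod>x\<in>S. ?t) * (\<Prod>x\<in>?V - S. ?s)"
        by (simp only: prod_constant)
    qed simp
    also have "\<dots> = (\<Prod>x\<in>?V. ?t + ?s)" by (rule prod_add[OF pair_finite_verts, symmetric])
    also have "?t + ?s = 1" by simp
    finally show ?thesis by simp
  qed
  moreover have "(\<Sum>S\<in>Pow ?V - ?C. ?t ^ card S * ?s ^ (?n - card S)) = H"
  proof -
    have "(\<Sum>S\<in>Pow ?V - ?C. ?t ^ card S * ?s ^ (?n - card S)) = (\<Sum>U\<in>?I. ?s ^ card U * ?t ^ (?n - card U))"
    proof (rule sum.reindex_bij_witness[of _ "\<lambda>U. ?V - U" "\<lambda>S. ?V - S"])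
      fix S assume S: "S \<in> Pow ?V - ?C"
      then have "independent_set G (?V - S)" using vertex_cover_iff_independent_compl by auto
      then show "?V - S \<in> ?I" by simp
      have "card (?V - S) = ?n - card S" "card S \<le> ?n"
        using S finite_subset[OF _ pair_finite_verts, of S] card_mono[OF pair_finite_verts, of S]
        by (auto intro: card_Diff_subset)
      then show "?s ^ card (?V - S) * ?t ^ (?n - card (?V - S)) = ?t ^ card S * ?s ^ (?n - card S)"
        by (simp add: mult.commute)
    next
      fix U assume U: "U \<in> ?I"
      then have "?V - (?V - U) = U" by (auto simp: independent_set_def)
      then show "?V - U \<in> Pow ?V - ?C" "?V - (?V - U) = U"
        using U vertex_cover_iff_independent_compl[of "?V - U"] by auto
    qed auto
    also have "\<dots> = H"
      unfolding H_def independence_poly_eq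
      by (rule Ind.sum_faces_eq_homogenization) (use alpha in \<open>simp add: independence_number_eq\<close>)
    finally show ?thesis .
  qed
  moreover have "(\<Sum>S\<in>Pow ?V. ?t ^ card S * ?s ^ (?n - card S))
      = (\<Sum>S\<in>Pow ?V - ?C. ?t ^ card S * ?s ^ (?n - card S)) + (\<Sum>S\<in>?C. ?t ^ card S * ?s ^ (?n - card S))"
    using pair_finite_verts by (intro sum.subset_diff) auto
  ultimately have eq: "?s ^ 2 * ?h = 1 - H" by (simp only: eq_diff_eq)
  have "degree H = ?n - mult_minus_one G"
  proof -
    have "degree (independence_poly G) \<le> ?n"
      using Ind.degree_f_poly_le alpha by (simp add: independence_poly_eq independence_number_eq)
    from degree_homogenization[OF _ this, of "- 1" 1] show ?thesis
      using Ind.f_poly_nonzero by (simp add: H_def independence_poly_eq mult_minus_one_eq)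
  qed
  moreover have "0 < ?n - mult_minus_one G" using mult_minus_one_le alpha by simp
  ultimately have deg: "degree (?s ^ 2 * ?h) = ?n - mult_minus_one G" "degree (?s ^ 2 * ?h) > 0"
    using degree_add_eq_right[of 1 "- H"] by (simp_all add: eq)
  then have "?h \<noteq> 0" by auto
  then have "degree (?s ^ 2 * ?h) = 2 + degree ?h"
    by (subst degree_mult_eq) (simp_all add: degree_power_eq)
  then show ?thesis
    unfolding cover_ideal_eq_stanley_reisner Cov.h_poly_quot_stanley_reisner using deg by simp
qed

end

theorem theorem4p4:
  fixes G :: "'v pair_pre_digraph"
  assumes "pair_graph G"
  shows "int (degree (h_poly_quot (pverts G) (edge_ideal G :: ('v, 'k::field) mpoly set)))
           = int (independence_number G) - int (mult_minus_one G)
       \<and> (parcs G \<noteq> {} \<longrightarrow>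
           int (degree (h_poly_quot (pverts G) (cover_ideal G :: ('v, 'k) mpoly set)))
           = int (card (pverts G)) - 2 - int (mult_minus_one G))
       \<and> (degree (h_poly_quot (pverts G) (edge_ideal G :: ('v, 'k) mpoly set))
           = independence_number G
          \<longleftrightarrow> poly (independence_poly G) (-1) \<noteq> 0)"
proof -
  interpret pair_graph G by fact
  interpret Ind: simplicial_complex "pverts G" "{S. independent_set G S}"
    by (rule independence_complex)
  have "int (degree (h_poly_quot (pverts G) (cover_ideal G :: ('v, 'k) mpoly set)))
      = int (card (pverts G)) - 2 - int (mult_minus_one G)" if "parcs G \<noteq> {}"
    using degree_h_poly_cover_ideal[OF that, where 'k = 'k] by linarith
  moreover have "mult_minus_one G = 0 \<longleftrightarrow> poly (independence_poly G) (-1) \<noteq> 0"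
  proof -
    have "independence_poly G \<noteq> 0" using Ind.f_poly_nonzero by (simp add: independence_poly_eq)
    then show ?thesis by (simp add: mult_minus_one_eq order_root)
  qed
  moreover have "independence_number G - mult_minus_one G = independence_number G \<longleftrightarrow> mult_minus_one G = 0"
    using mult_minus_one_le by auto
  ultimately show ?thesis
    using mult_minus_one_le by (simp add: degree_h_poly_edge_ideal of_nat_diff)
qed

end
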